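(* Let $d\ge 1$ and let $q$ be a power of an odd prime. Let $\mathcal{G}=(V,E)$ be a distance graph with vertices $V=\{v_1,\dots,v_n\}$, $m\ge 1$ edges, and maximum vertex degree $t$. Let $A\subseteq\mathbf{F}_q^d$ with $|A|=\alpha q^d$ and \[ \alpha \geq 4 m q^{t-\frac{d+1}{2}}. \] Then \[ \Big| \mathcal{N}_{\mathcal{G}}(A) - \alpha^n \Big| \leq 4 m\, \alpha^{n-1} q^{t-\frac{d+1}{2}}, \] where \[ \mathcal{N}_{\mathcal{G}}(A) := \mathbf{E}_{x_1,\dots,x_n} \prod_{i=1}^n \Big( 1_A(x_i) \prod_{j=i+1}^n \sigma_{i,j}(x_i-x_j) \Big). \]
   Context: $\mathbf{F}_q$ is the finite field with $q$ elements (odd characteristic). For $x\in\mathbf{F}_q^d$, $|x|^2 := \sum_{j=1}^d x_j^2$. A distance graph is a finite simple graph $\mathcal{G}=(V,E)$ together with a nonzero length $\lambda_e\in\mathbf{F}_q^*$ for each edge $e\in E$; the edge joining $v_i$ and $v_j$ is denoted $e_{i,j}$. For $\lambda\in\mathbf{F}_q$, $\sigma_\lambda(x):=q$ if $|x|^2=\lambda$ and $0$ otherwise. Define $\sigma_{i,j}(x) := \sigma_{\lambda_{e_{i,j}}}(x)$ if $v_i$ and $v_j$ are adjacent, and $\sigma_{i,j}(x):=1$ otherwise. For $f:\mathbf{F}_q^d\to\mathbf{C}$, $\mathbf{E}_x f(x):=q^{-d}\sum_{x\in\mathbf{F}_q^d}f(x)$, and $\mathbf{E}_{x_1,\dots,x_n}:=\mathbf{E}_{x_1}\cdots\mathbf{E}_{x_n}$.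 $1_A$ is the indicator function of $A$. *)

theory Defs
  imports "HOL-Analysis.Analysis"
begin

definition sqnorm :: "'k::{field,finite} ^ 'd::finite \<Rightarrow> 'k" where
  "sqnorm x = (\<Sum>j\<in>UNIV. x $ j * x $ j)"

definition sigma_len :: "'k::{field,finite} \<Rightarrow> 'k ^ 'd::finite \<Rightarrow> real" where
  "sigma_len lam x = (if sqnorm x = lam then real CARD('k) else 0)"

text \<open>Distance graph on vertices 0..n-1 (v_{i+1} is vertex i): symmetric irreflexive
  edge relation E, lengths L i j (nonzero on edges, symmetric).\<close>
definition distance_graph :: "nat \<Rightarrow> (nat \<Rightarrow> nat \<Rightarrow> bool) \<Rightarrow> (nat \<Rightarrow> nat \<Rightarrow> 'k::{field,finite}) \<Rightarrow> bool" where
  "distance_graph n E L \<longleftrightarrow>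
     (\<forall>i j. E i j \<longrightarrow> i < n \<and> j < n \<and> i \<noteq> j \<and> E j i \<and> L i j \<noteq> 0 \<and> L i j = L j i)"

definition num_edges :: "nat \<Rightarrow> (nat \<Rightarrow> nat \<Rightarrow> bool) \<Rightarrow> nat" where
  "num_edges n E = card {(i, j). i < j \<and> j < n \<and> E i j}"

definition degree :: "nat \<Rightarrow> (nat \<Rightarrow> nat \<Rightarrow> bool) \<Rightarrow> nat \<Rightarrow> nat" where
  "degree n E i = card {j. j < n \<and> E i j}"

definition max_degree :: "nat \<Rightarrow> (nat \<Rightarrow> nat \<Rightarrow> bool) \<Rightarrow> nat" where
  "max_degree n E = Max (degree n E ` {..<n})"

definition sigma_ij :: "(nat \<Rightarrow> nat \<Rightarrow> bool) \<Rightarrow> (nat \<Rightarrow> nat \<Rightarrow> 'k::{field,finite})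
    \<Rightarrow> nat \<Rightarrow> nat \<Rightarrow> 'k ^ 'd::finite \<Rightarrow> real" where
  "sigma_ij E L i j x = (if E i j then sigma_len (L i j) x else 1)"

definition count_G :: "nat \<Rightarrow> (nat \<Rightarrow> nat \<Rightarrow> bool) \<Rightarrow> (nat \<Rightarrow> nat \<Rightarrow> 'k::{field,finite})
    \<Rightarrow> ('k ^ 'd::finite) set \<Rightarrow> real" where
  "count_G n E L A =
     (1 / real CARD('k) ^ CARD('d)) ^ n *
     (\<Sum>x\<in>PiE {..<n} (\<lambda>_. UNIV).
        \<Prod>i<n. (indicator A (x i) * (\<Prod>j\<in>{i<..<n}. sigma_ij E L i j (x i - x j))))"

end

theory Submission
  imports "HOL-Algebra.Algebraic_Closure_Type" Defs
begin

text \<open>The sphere weight is \<open>\<sigma> = 1 + \<tau>\<close> with all Fourier coefficients of \<open>\<tau>\<close> at most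
  \<open>2 q ^ (-(d-1)/2)\<close>. Adding the edges one at a time, the insertion of an edge \<open>ij\<close> changes the
  count by an average of a bilinear form with kernel \<open>\<tau>(x\<^sub>i - x\<^sub>j)\<close>; Cauchy-Schwarz bounds it by counts for
  graphs with one vertex less, which are at most twice their main term by induction and the lower bound
  on \<open>\<alpha>\<close>.

  The Fourier coefficients are Salie sums in odd dimension and Kloosterman sums in even dimension.
  For the latter let \<open>K\<^sub>j\<close> be the sum over the extension with \<open>Q\<^sub>j\<close> elements, of degree \<open>2 ^ j\<close>, for the
  character composed with the trace. Counting elements by trace and norm gives
  \<open>K\<^sub>j\<^sub>+\<^sub>1 = 2 Q\<^sub>j - K\<^sub>j\<^sup>2\<close>, so \<open>|K\<^sub>0| > 2 \<surd>q\<close> would make \<open>|K\<^sub>j| / \<surd>Q\<^sub>j\<close> unbounded.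
  This is excluded by showing with Stepanov's method that \<open>as + b/s = x ^ q - x + c\<close> has at most
  \<open>Q\<^sub>j + O(\<surd>Q\<^sub>j)\<close> solutions over the extension, for all but two \<open>c\<close>: since \<open>Q\<^sub>j = r\<^sup>2\<close>, a nonzero polynomial of small degree vanishing at the points is
  found by making its \<open>r\<close>-th power, reduced by \<open>x ^ Q\<^sub>j = x\<close>, vanish identically; no derivatives are
  needed.\<close>

section \<open>Polynomials over finite fields\<close>

text \<open>The sharp constant 2 in the Weil bound costs only a crude estimate: on
  \<open>|K_j| / sqrt Q_j\<close> the recursion acts at least as strongly as
  \<open>A -> A^2 - 2\<close>, which drives every value above 2 to infinity, so a bound
  \<open>O(sqrt Q_j)\<close> whose constant may depend on \<open>q\<close> but not on
  \<open>j\<close> suffices. The factor 4 in the theorem is 2 * 2. One 2 is the bound for the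
  Fourier coefficients of the sphere, the other is the allowance that a count on fewer vertices is
  at most twice its main term. The lower bound on \<alpha> says exactly that the total error does
  not exceed the main term, which is what lets this allowance pass through the induction.\<close>

lemma order_simple_root:
  fixes f :: "'a::field poly"
  assumes "poly f z = 0" "poly (pderiv f) z \<noteq> 0"
  shows "Polynomial.order z f = 1"
proof -
  obtain g where g: "f = [:-z, 1:] * g"
    using assms(1) by (auto simp: poly_eq_0_iff_dvd)
  have gz: "poly g z \<noteq> 0"
    using assms(2) unfolding g pderiv_mult by (simp add: pderiv_pCons)
  have "Polynomial.order z [:-z, 1:] = 1"
    using order_power_n_n[of z 1] by simp
  moreover have "[:-z, 1:] * g \<noteq> 0"
    using gz by (metis mult_eq_0_iff one_neq_zero pCons_eq_0_iff poly_0)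
  ultimately show ?thesis
    unfolding g using gz by (subst order_mult) (simp_all add: order_0I)
qed

text \<open>A root occurring twice in the factorisation into linear factors would also be a zero of
  the derivative, so the multiset of roots is a set.\<close>

lemma card_roots_alg_closed:
  fixes f :: "'a::alg_closed_field poly"
  assumes simple: "\<And>z. poly f z = 0 \<Longrightarrow> poly (pderiv f) z \<noteq> 0" and "f \<noteq> 0"
  shows "card {z. poly f z = 0} = Polynomial.degree f"
proof -
  obtain A where A: "size A = Polynomial.degree f"
      "f = smult (lead_coeff f) (\<Prod>x\<in>#A. [:-x, 1:])"
    using alg_closed_imp_factorization[OF \<open>f \<noteq> 0\<close>] by blast
  have lc: "lead_coeff f \<noteq> 0"
    using \<open>f \<noteq> 0\<close> by simp
  have roots: "{z. poly f z = 0} = set_mset A"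
    using lc by (subst A(2)) (auto simp: poly_prod_mset prod_mset_zero_iff)
  have "count A z = 1" if "z \<in># A" for z
  proof (rule ccontr)
    assume "count A z \<noteq> 1"
    with that have "2 \<le> count A z"
      by (metis One_nat_def Suc_1 count_eq_zero_iff le_Suc_eq le_simps(3) not_less_eq_eq numeral_2_eq_2 zero_less_iff_neq_zero)
    then have "{#z, z#} \<subseteq># A"
      by (simp add: mset_subset_eqI subseteq_mset_def)
    then obtain B where B: "A = {#z, z#} + B"
      by (metis subset_mset.add_diff_inverse)
    have f: "f = [:-z, 1:] * ([:-z, 1:] * smult (lead_coeff f) (\<Prod>x\<in>#B. [:-x, 1:]))" (is "_ = ?l * ?g")
      by (subst A(2), simp only: B) (simp add: mult.assoc)
    have "poly (pderiv f) z = 0"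
      by (subst f, subst pderiv_mult) simp
    moreover have "poly f z = 0"
      using that roots by blast
    ultimately show False
      using simple by blast
  qed
  then have "A = mset_set (set_mset A)"
    by (intro multiset_eqI) (metis count_eq_zero_iff count_mset_set(1,3) finite_set_mset)
  then have "size A = card (set_mset A)"
    by (metis size_mset_set)
  then show ?thesis
    using A(1) roots by simp
qed

lemma CHAR_power_eq_0:
  assumes "n > 0"
  shows "(of_nat (CHAR('a::comm_semiring_1) ^ n) :: 'a) = 0"
  using assms unfolding of_nat_eq_0_iff_char_dvd by (simp add: dvd_power)

text \<open>The derivative of \<open>X^Q - X\<close> is the constant -1, so no root is multiple. The
  fixed set serves as the field with \<open>Q\<close> elements inside the closed field.\<close>

lemma card_frobenius_fixed:
  assumes "prime CHAR('a::alg_closed_field)" "Q = CHAR('a) ^ n" "n > 0"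
  shows "card {x::'a. x ^ Q = x} = Q"
proof -
  define f :: "'a poly" where "f = monom 1 Q - monom 1 1"
  have Q: "Q > 1"
    using assms prime_gt_1_nat[of "CHAR('a)"] one_less_power by blast
  have deg: "Polynomial.degree f = Q"
    unfolding f_def diff_conv_add_uminus using Q by (subst degree_add_eq_left) (auto simp: degree_monom_eq)
  have "poly (pderiv f) z \<noteq> 0" for z
    using CHAR_power_eq_0[of n, where 'a = 'a] assms by (simp add: f_def pderiv_diff pderiv_monom poly_monom power_0_left)
  moreover have "f \<noteq> 0"
    using deg Q by auto
  ultimately have "card {z. poly f z = 0} = Q"
    using card_roots_alg_closed deg by blast
  then show ?thesis
    by (simp add: f_def poly_monom)
qed

definition coeffs_in :: "'a::comm_ring_1 set \<Rightarrow> 'a poly \<Rightarrow> bool" where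
  "coeffs_in F p \<longleftrightarrow> (\<forall>i. coeff p i \<in> F)"

text \<open>The strict bound makes \<open>m\<close> the number of free coefficients; for
  \<open>m > 0\<close> the zero polynomial, of degree 0, is included.\<close>

definition polys_below :: "'a::comm_ring_1 set \<Rightarrow> nat \<Rightarrow> 'a poly set" where
  "polys_below F m = {p. coeffs_in F p \<and> Polynomial.degree p < m}"

lemma card_polys_below:
  assumes "finite F" "0 \<in> F" "m > 0"
  shows "finite (polys_below F m)" "card (polys_below F m) = card F ^ m"
proof -
  have "bij_betw (\<lambda>c. \<Sum>i<m. monom (c i) i) (PiE {..<m} (\<lambda>_. F)) (polys_below F m)"
  proof (rule bij_betw_byWitness[where f' = "\<lambda>p. restrict (coeff p) {..<m}"])
    show "\<forall>a\<in>{..<m} \<rightarrow>\<^sub>E F. restrict (coeff (\<Sum>i<m. monom (a i) i)) {..<m} = a"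
      by (auto simp: coeff_sum fun_eq_iff PiE_def extensional_def)
    show "\<forall>a'\<in>polys_below F m. (\<Sum>i<m. monom (restrict (coeff a') {..<m} i) i) = a'"
      by (auto simp: polys_below_def poly_eq_iff coeff_sum coeff_eq_0)
    show "(\<lambda>c. \<Sum>i<m. monom (c i) i) ` ({..<m} \<rightarrow>\<^sub>E F) \<subseteq> polys_below F m"
    proof clarify
      fix c assume c: "c \<in> {..<m} \<rightarrow>\<^sub>E F"
      have "Polynomial.degree (\<Sum>i<m. monom (c i) i) \<le> m - 1"
        by (rule degree_le) (auto simp: coeff_sum)
      with c \<open>m > 0\<close> \<open>0 \<in> F\<close> show "(\<Sum>i<m. monom (c i) i) \<in> polys_below F m"
        by (auto simp: polys_below_def coeffs_in_def coeff_sum PiE_def Pi_def)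
    qed
    show "(\<lambda>p. restrict (coeff p) {..<m}) ` polys_below F m \<subseteq> {..<m} \<rightarrow>\<^sub>E F"
      by (auto simp: polys_below_def coeffs_in_def split: if_splits)
  qed
  then show "finite (polys_below F m)" "card (polys_below F m) = card F ^ m"
    using assms by (auto simp: bij_betw_finite[symmetric] bij_betw_same_card[symmetric] finite_PiE card_PiE)
qed

definition subring_set :: "'a::comm_ring_1 set \<Rightarrow> bool" where
  "subring_set F \<longleftrightarrow> 0 \<in> F \<and> 1 \<in> F \<and> (\<forall>x\<in>F. \<forall>y\<in>F. x + y \<in> F \<and> x * y \<in> F \<and> x - y \<in> F)"

lemma subring_set_sum: "subring_set F \<Longrightarrow> (\<And>i. i \<in> I \<Longrightarrow> g i \<in> F) \<Longrightarrow> sum g I \<in> F"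
  by (induction I rule: infinite_finite_induct) (auto simp: subring_set_def)

lemma coeffs_in_closed:
  assumes F: "subring_set F"
  shows "coeffs_in F 0" "coeffs_in F 1"
    "coeffs_in F p \<Longrightarrow> coeffs_in F p' \<Longrightarrow> coeffs_in F (p + p')"
    "coeffs_in F p \<Longrightarrow> coeffs_in F p' \<Longrightarrow> coeffs_in F (p - p')"
    "coeffs_in F p \<Longrightarrow> coeffs_in F p' \<Longrightarrow> coeffs_in F (p * p')"
    "c \<in> F \<Longrightarrow> coeffs_in F (monom c k)"
  using F unfolding coeffs_in_def
  by (auto simp: subring_set_def coeff_mult intro!: subring_set_sum[OF F])

lemma coeffs_in_power: "subring_set F \<Longrightarrow> coeffs_in F p \<Longrightarrow> coeffs_in F (p ^ k)"
  by (induction k) (auto intro: coeffs_in_closed)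

lemma coeffs_in_sum: "subring_set F \<Longrightarrow> (\<And>i. i \<in> I \<Longrightarrow> coeffs_in F (g i)) \<Longrightarrow> coeffs_in F (sum g I)"
  by (induction I rule: infinite_finite_induct) (auto intro: coeffs_in_closed)

lemma CHAR_power_diff:
  fixes x y :: "'a::comm_ring_1"
  assumes "prime CHAR('a)" "r = CHAR('a) ^ e"
  shows "(x - y) ^ r = x ^ r - y ^ r"
  using freshmans_dream'[OF assms, of "x - y" y] by simp

lemma subring_set_fixed:
  assumes "prime CHAR('a::comm_ring_1)" "Q = CHAR('a) ^ n"
  shows "subring_set {x::'a. x ^ Q = x}"
  using assms CHAR_power_diff[OF assms] freshmans_dream'[OF assms] prime_gt_0_nat
  by (auto simp: subring_set_def power_mult_distrib power_0_left)

section \<open>Stepanov's method in Bombieri's form\<close>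

lemma monom_dvd_imp_eq_0:
  fixes p q :: "'a::comm_ring_1 poly"
  assumes "monom 1 r dvd p" "Polynomial.degree p < r"
  shows "p = 0"
proof -
  obtain g where g: "p = monom 1 r * g"
    using assms(1) by blast
  have "coeff p i = 0" if "i < r" for i
    using that by (simp add: g coeff_monom_mult)
  then have "coeff p i = 0" for i
    using assms(2) by (cases "i < r") (auto simp: coeff_eq_0)
  then show ?thesis
    by (simp add: poly_eq_iff)
qed

text \<open>An expansion in powers of \<open>X^r\<close> whose first \<open>k0\<close> digits
  vanish: after the common power is taken out, only the digit \<open>u k0\<close> is visible modulo
  \<open>X^r\<close>.\<close>

lemma split_power_sum:
  fixes u :: "nat \<Rightarrow> 'a::comm_ring_1 poly"
  assumes "k0 < l" and "\<And>k. k < k0 \<Longrightarrow> u k = 0"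
  shows "\<exists>u'. (\<Sum>k<l. monom 1 (k * r) * u k) = monom 1 (k0 * r) * (u k0 + monom 1 r * u')"
proof -
  have "(\<Sum>k<l. monom 1 (k * r) * u k) = (\<Sum>k\<in>{k0..<l}. monom 1 (k * r) * u k)"
    using assms by (intro sum.mono_neutral_right) auto
  also have "\<dots> = monom 1 (k0 * r) * u k0 + (\<Sum>k\<in>{Suc k0..<l}. monom 1 (k * r) * u k)"
    using assms(1) by (simp add: sum.atLeast_Suc_lessThan)
  also have "(\<Sum>k\<in>{Suc k0..<l}. monom 1 (k * r) * u k)
      = monom 1 (k0 * r) * (monom 1 r * (\<Sum>k\<in>{Suc k0..<l}. monom 1 ((k - Suc k0) * r) * u k))"
    unfolding sum_distrib_left
  proof (rule sum.cong[OF refl])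
    fix k assume "k \<in> {Suc k0..<l}"
    then have "Suc k0 \<le> k"
      by simp
    then have "k * r = k0 * r + r + (k - Suc k0) * r"
      by (metis add_mult_distrib le_add_diff_inverse mult_Suc add.commute)
    then show "monom 1 (k * r) * u k = monom 1 (k0 * r) * (monom 1 r * (monom 1 ((k - Suc k0) * r) * u k))"
      by (simp only: mult.assoc[symmetric] mult_monom mult_1 add.assoc)
  qed
  finally have "(\<Sum>k<l. monom 1 (k * r) * u k) = monom 1 (k0 * r) * (u k0 + monom 1 r *
      (\<Sum>k\<in>{Suc k0..<l}. monom 1 ((k - Suc k0) * r) * u k))"
    by (simp only: distrib_left)
  then show ?thesis ..
qed

text \<open>Used with \<open>m = X^r\<close>, where \<open>c + m * g\<close> is the expansion of
  \<open>f ^ r\<close>: modulo \<open>m\<close> only the lowest digits \<open>a\<close> and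
  \<open>d\<close> remain.\<close>

lemma square_relation_mod:
  fixes a d u v m f g c :: "'a::comm_ring_1"
  assumes "(a + m * u)\<^sup>2 = (d + m * v)\<^sup>2 * (f * (c + m * g))"
  shows "a\<^sup>2 - c * (d\<^sup>2 * f) = m * ((d + m * v)\<^sup>2 * f * g + c * (f * v * (2 * d + m * v)) - u * (2 * a + m * u))"
proof -
  have "a\<^sup>2 = (a + m * u)\<^sup>2 - m * (u * (2 * a + m * u))"
    by (simp add: algebra_simps power2_eq_square)
  also have "\<dots> = (d + m * v)\<^sup>2 * (f * (c + m * g)) - m * (u * (2 * a + m * u))"
    by (simp only: assms)
  finally have *: "a\<^sup>2 = (d + m * v)\<^sup>2 * (f * (c + m * g)) - m * (u * (2 * a + m * u))" .
  show ?thesis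
    unfolding * by (simp add: algebra_simps power2_eq_square)
qed

text \<open>With \<open>r = 2w + 1\<close>, squaring turns a relation \<open>U + V f ^ (w + 1) = 0\<close> into
  \<open>U ^ 2 = V ^ 2 * f * f ^ r\<close>, where \<open>f ^ r\<close> is constant modulo \<open>X ^ r\<close>; comparing lowest terms then
  contradicts that \<open>f\<close> has a simple root.\<close>

lemma stepanov_independence:
  fixes f :: "'a::field poly" and al de :: "nat \<Rightarrow> 'a poly"
  assumes char: "prime CHAR('a)" "r = CHAR('a) ^ e" "r = 2 * w + 1" "q \<le> w"
    and f: "Polynomial.degree f \<le> 2 * q" "poly f 0 \<noteq> 0" "poly f z = 0" "poly (pderiv f) z \<noteq> 0"
    and deg: "\<And>k. k < l \<Longrightarrow> Polynomial.degree (al k) < w + 1"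
      "\<And>k. k < l \<Longrightarrow> Polynomial.degree (de k) < w + 1 - q"
    and G: "(\<Sum>k<l. monom 1 (k * r) * (al k + de k * f ^ (w + 1))) = 0"
    and k: "k < l"
  shows "al k = 0 \<and> de k = 0"
proof (rule ccontr)
  assume "\<not> (al k = 0 \<and> de k = 0)"
  define k0 where "k0 = (LEAST k. \<not> (al k = 0 \<and> de k = 0))"
  have k0: "\<not> (al k0 = 0 \<and> de k0 = 0)" "k0 \<le> k"
    unfolding k0_def using \<open>\<not> (al k = 0 \<and> de k = 0)\<close> by (rule LeastI, intro Least_le)
  have below: "al i = 0" "de i = 0" if "i < k0" for i
    using not_less_Least that unfolding k0_def by blast+
  have "k0 < l"
    using k0(2) k by simp
  obtain u where u: "(\<Sum>k<l. monom 1 (k * r) * al k) = monom 1 (k0 * r) * (al k0 + monom 1 r * u)"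
    using split_power_sum[of k0 l al] \<open>k0 < l\<close> below by blast
  obtain v where v: "(\<Sum>k<l. monom 1 (k * r) * de k) = monom 1 (k0 * r) * (de k0 + monom 1 r * v)"
    using split_power_sum[of k0 l de] \<open>k0 < l\<close> below by blast
  have "(\<Sum>k<l. monom 1 (k * r) * al k) + (\<Sum>k<l. monom 1 (k * r) * de k) * f ^ (w + 1) = 0"
    using G by (simp add: sum_distrib_right sum.distrib distrib_left mult.assoc)
  then have "monom 1 (k0 * r) * ((al k0 + monom 1 r * u) + (de k0 + monom 1 r * v) * f ^ (w + 1)) = 0"
    by (simp only: u v) (simp add: algebra_simps)
  then have "(al k0 + monom 1 r * u) + (de k0 + monom 1 r * v) * f ^ (w + 1) = 0"
    by (simp add: monom_eq_0_iff)
  then have "(al k0 + monom 1 r * u) = - ((de k0 + monom 1 r * v) * f ^ (w + 1))"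
    by (simp add: add_eq_0_iff2)
  then have "(al k0 + monom 1 r * u)\<^sup>2 = (de k0 + monom 1 r * v)\<^sup>2 * (f ^ (w + 1))\<^sup>2"
    by (simp add: power_mult_distrib)
  also have "(f ^ (w + 1))\<^sup>2 = f * f ^ r"
    unfolding char(3) power_mult[symmetric] power_Suc[symmetric] by (simp add: algebra_simps)
  finally have sq: "(al k0 + monom 1 r * u)\<^sup>2 = (de k0 + monom 1 r * v)\<^sup>2 * (f * f ^ r)" .
  define c where "c = poly f 0 ^ r"
  have "c \<noteq> 0"
    using f(2) by (simp add: c_def)
  have "[:-0, 1:] dvd f - [:poly f 0:]"
    by (subst poly_eq_0_iff_dvd[symmetric]) simp
  then have "monom 1 1 dvd f - [:poly f 0:]"
    by (simp add: monom_altdef)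
  then have "monom 1 1 ^ r dvd (f - [:poly f 0:]) ^ r"
    by (rule dvd_power_same)
  also have "(f - [:poly f 0:]) ^ r = f ^ r - [:c:]"
    using CHAR_power_diff[of r e f] char by (simp add: c_def poly_const_pow)
  finally have "monom 1 r dvd f ^ r - [:c:]"
    by (simp add: monom_power)
  then obtain g where g: "f ^ r = [:c:] + monom 1 r * g"
    by (metis add.commute diff_add_cancel dvdE)
  have "(al k0)\<^sup>2 - [:c:] * ((de k0)\<^sup>2 * f)
      = monom 1 r * ((de k0 + monom 1 r * v)\<^sup>2 * f * g + [:c:] * (f * v * (2 * de k0 + monom 1 r * v))
        - u * (2 * al k0 + monom 1 r * u))"
    using sq[unfolded g] by (rule square_relation_mod)
  then have "(al k0)\<^sup>2 - smult c ((de k0)\<^sup>2 * f)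
      = monom 1 r * ((de k0 + monom 1 r * v)\<^sup>2 * f * g + [:c:] * (f * v * (2 * de k0 + monom 1 r * v))
        - u * (2 * al k0 + monom 1 r * u))"
    by simp
  then have "monom 1 r dvd (al k0)\<^sup>2 - smult c ((de k0)\<^sup>2 * f)"
    by (metis dvd_triv_left)
  \<comment> \<open>The degree bounds on \<open>al\<close> and \<open>de\<close> are made for this:
    the first term has degree at most \<open>2w\<close>, the second at most
    \<open>2(w - q) + 2q = 2w\<close>, and \<open>r = 2w + 1\<close>. Divisibility by
    \<open>X^r\<close> then forces the difference to vanish.\<close>
  moreover have "Polynomial.degree ((al k0)\<^sup>2 - smult c ((de k0)\<^sup>2 * f)) < r"
  proof (rule degree_diff_less)
    have "Polynomial.degree ((al k0)\<^sup>2) \<le> Polynomial.degree (al k0) * 2"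
      by (rule degree_power_le)
    then show "Polynomial.degree ((al k0)\<^sup>2) < r"
      using deg(1)[OF \<open>k0 < l\<close>] char(3) by linarith
    have "Polynomial.degree (smult c ((de k0)\<^sup>2 * f)) \<le> Polynomial.degree ((de k0)\<^sup>2 * f)"
      by (rule degree_smult_le)
    also have "\<dots> \<le> Polynomial.degree ((de k0)\<^sup>2) + Polynomial.degree f"
      by (rule degree_mult_le)
    also have "\<dots> \<le> Polynomial.degree (de k0) * 2 + 2 * q"
      using degree_power_le[of "de k0" 2] f(1) by linarith
    finally show "Polynomial.degree (smult c ((de k0)\<^sup>2 * f)) < r"
      using deg(2)[OF \<open>k0 < l\<close>] char(3,4) by linarith
  qed
  ultimately have eq: "(al k0)\<^sup>2 = smult c ((de k0)\<^sup>2 * f)"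
    using monom_dvd_imp_eq_0 by (metis eq_iff_diff_eq_0)
  have "f \<noteq> 0"
    using f(2) by auto
  have nz: "al k0 \<noteq> 0" "de k0 \<noteq> 0"
    using k0(1) eq \<open>c \<noteq> 0\<close> \<open>f \<noteq> 0\<close> by auto
  \<comment> \<open>Parity of the order at \<open>z\<close>: even for a square, odd for a square
    times \<open>f\<close>, since \<open>z\<close> is a simple root of \<open>f\<close>.\<close>
  have "Polynomial.order z ((al k0)\<^sup>2) = 2 * Polynomial.order z (al k0)"
    using nz by (simp add: power2_eq_square order_mult)
  moreover have "Polynomial.order z (smult c ((de k0)\<^sup>2 * f)) = 2 * Polynomial.order z (de k0) + 1"
    using nz \<open>c \<noteq> 0\<close> \<open>f \<noteq> 0\<close> order_simple_root[OF f(3,4)]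
    by (simp add: power2_eq_square order_mult order_smult)
  ultimately have "2 * Polynomial.order z (al k0) = 2 * Polynomial.order z (de k0) + 1"
    using eq by simp
  then show False
    by presburger
qed

text \<open>The exponent \<open>2w(w + 1)\<close> is \<open>(r^2 - 1) / 2\<close>, so the set
  consists of the points of the field with \<open>r^2\<close> elements where \<open>f\<close> is a
  nonzero square. The bound equals \<open>r w + w + 2 q r\<close>, half the field up to
  \<open>O(q r)\<close>.\<close>

theorem stepanov_bound:
  fixes f :: "'a::alg_closed_field poly"
  assumes char: "prime CHAR('a)" "r = CHAR('a) ^ e" "r = 2 * w + 1" "q \<le> w" "e > 0"
    and f: "coeffs_in {x. x ^ (r * r) = x} f" "Polynomial.degree f \<le> 2 * q"
      "poly f 0 \<noteq> 0" "poly f z = 0" "poly (pderiv f) z \<noteq> 0"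
  shows "card {x. x ^ (r * r) = x \<and> poly f x ^ (2 * w * (w + 1)) = 1} \<le> r * (w + q) + w + q * r"
proof -
  define F where "F = {x::'a. x ^ (r * r) = x}"
  have rr: "r * r = CHAR('a) ^ (e + e)"
    by (simp add: char(2) power_add)
  have F: "subring_set F"
    unfolding F_def using subring_set_fixed[OF char(1) rr] .
  have cardF: "card F = r * r"
    unfolding F_def using card_frobenius_fixed[OF char(1) rr] char(5) by simp
  have r: "r \<ge> 3"
  proof -
    have "r > 1"
      using char prime_gt_1_nat[of "CHAR('a)"] one_less_power by blast
    then show ?thesis using char(3) by (cases w) auto
  qed
  have finF: "finite F"
    using cardF r by (intro card_ge_0_finite) simp
  have F0: "0 \<in> F"
    using F by (simp add: subring_set_def)
  \<comment> \<open>There are \<open>l * (2w + 2 - q)\<close> free coefficients against the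
    \<open>M\<close> coefficients of \<open>Z g\<close>. With this \<open>l\<close> the excess is
    \<open>2w + 1 + q(w - q) - q\<close>, positive because \<open>q\<close> is at most
    \<open>w\<close>.\<close>
  define l where "l = w + 1 + q"
  define M where "M = l + r * w + q"
  define D where "D = PiE {..<l} (\<lambda>_. polys_below F (w + 1) \<times> polys_below F (w + 1 - q))"
  \<comment> \<open>\<open>Z\<close> is what the \<open>r\<close>-th power of the polynomial
    \<open>G\<close> below becomes at a counted point, after \<open>x ^ (r * r) = x\<close> has
    lowered the exponents.\<close>
  define Z where "Z g = (\<Sum>k<l. monom 1 k * (fst (g k) ^ r + snd (g k) ^ r * f ^ (w + 1)))" for g :: "nat \<Rightarrow> 'a poly \<times> 'a poly"
  have "card D = ((r * r) ^ (w + 1) * (r * r) ^ (w + 1 - q)) ^ l"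
    unfolding D_def using card_polys_below[OF finF F0] char(4) by (simp add: card_PiE card_cartesian_product cardF)
  also have "\<dots> = (r * r) ^ (l * (w + 1 + (w + 1 - q)))"
    by (simp only: power_add[symmetric] power_mult[symmetric] mult.commute)
  finally have cardD: "card D = (r * r) ^ (l * (w + 1 + (w + 1 - q)))" .
  have ZM: "Z g \<in> polys_below F M" if g: "g \<in> D" for g
  proof -
    have gk: "coeffs_in F (fst (g k))" "Polynomial.degree (fst (g k)) \<le> w"
      "coeffs_in F (snd (g k))" "Polynomial.degree (snd (g k)) \<le> w - q" if "k < l" for k
      using PiE_mem[OF g[unfolded D_def], of k] that char(4) by (auto simp: polys_below_def)
    have "Polynomial.degree (monom 1 k * (fst (g k) ^ r + snd (g k) ^ r * f ^ (w + 1))) \<le> M - 1" if "k < l" for k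
    proof -
      have "Polynomial.degree (fst (g k) ^ r) \<le> w * r"
        using degree_power_le[of "fst (g k)" r] mult_le_mono1[OF gk(2)[OF that]] le_trans by blast
      moreover have "Polynomial.degree (snd (g k) ^ r) \<le> (w - q) * r"
        using degree_power_le[of "snd (g k)" r] mult_le_mono1[OF gk(4)[OF that]] le_trans by blast
      moreover have "Polynomial.degree (f ^ (w + 1)) \<le> 2 * q * (w + 1)"
        using degree_power_le[of "f" "w + 1"] mult_le_mono1[OF f(2)] le_trans by blast
      moreover have "(w - q) * r + 2 * q * (w + 1) = w * r + q"
      proof -
        have "(w - q) * r + q * r = w * r"
          using char(4) by (metis add_mult_distrib le_add_diff_inverse2)
        moreover have "2 * q * (w + 1) = q * r + q"
          unfolding char(3) by (simp add: algebra_simps)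
        ultimately show ?thesis by simp
      qed
      ultimately have "Polynomial.degree (fst (g k) ^ r + snd (g k) ^ r * f ^ (w + 1)) \<le> w * r + q"
        using degree_mult_le[of "snd (g k) ^ r" "f ^ (w + 1)"] by (intro degree_add_le) linarith+
      moreover have "Polynomial.degree (monom (1::'a) k) \<le> k"
        by (rule degree_monom_le)
      ultimately have "Polynomial.degree (monom 1 k * (fst (g k) ^ r + snd (g k) ^ r * f ^ (w + 1))) \<le> k + (w * r + q)"
        using degree_mult_le[of "monom 1 k" "fst (g k) ^ r + snd (g k) ^ r * f ^ (w + 1)"] by linarith
      then show ?thesis
        using that by (simp add: M_def mult.commute)
    qed
    then have "Polynomial.degree (Z g) \<le> M - 1"
      unfolding Z_def by (intro degree_sum_le) auto
    moreover have "M > 0"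
      by (simp add: M_def l_def)
    moreover have "coeffs_in F (Z g)"
      unfolding Z_def using gk f(1) F
      by (intro coeffs_in_sum coeffs_in_closed coeffs_in_power) (auto simp: F_def[symmetric] subring_set_def)
    ultimately show ?thesis
      by (simp add: polys_below_def)
  qed
  have "M < l * (w + 1 + (w + 1 - q))"
  proof -
    obtain t where t: "w = q + t"
      using char(4) le_Suc_ex by blast
    show ?thesis
      using r by (simp add: M_def l_def char(3) t algebra_simps)
  qed
  then have "card (polys_below F M) < card D"
    using card_polys_below[OF finF F0, of M] r cardD cardF
    by (simp add: M_def l_def power_strict_increasing one_less_mult)
  then have "\<not> inj_on Z D"
    using ZM card_polys_below(1)[OF finF F0, of M]
    by (metis (no_types, lifting) card_inj_on_le image_subsetI not_le M_def l_def add_gr_0 zero_less_one)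
  then obtain g g' where gg: "g \<in> D" "g' \<in> D" "Z g = Z g'" "g \<noteq> g'"
    by (auto simp: inj_on_def)
  \<comment> \<open>\<open>Z\<close> is additive because \<open>r\<close>-th powers are, but only
    semilinear over \<open>F\<close>; so the pigeonhole principle and a difference of two preimages
    take the place of a kernel.\<close>
  define al where "al k = fst (g k) - fst (g' k)" for k
  define de where "de k = snd (g k) - snd (g' k)" for k
  have mem: "g k \<in> polys_below F (w + 1) \<times> polys_below F (w + 1 - q)"
       "g' k \<in> polys_below F (w + 1) \<times> polys_below F (w + 1 - q)" if "k < l" for k
    using PiE_mem[OF gg(1)[unfolded D_def], of k] PiE_mem[OF gg(2)[unfolded D_def], of k] that by auto
  have deg: "Polynomial.degree (al k) < w + 1" "Polynomial.degree (de k) < w + 1 - q" if "k < l" for k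
    using mem[OF that] unfolding al_def de_def polys_below_def by (auto intro!: degree_diff_less)
  have pow: "(a - b) ^ r = a ^ r - b ^ r" for a b :: "'a poly"
    using CHAR_power_diff[of r e a b] char by simp
  have "Z g - Z g' = (\<Sum>k<l. monom 1 k * (al k ^ r + de k ^ r * f ^ (w + 1)))"
    unfolding Z_def sum_subtractf[symmetric] al_def de_def pow by (intro sum.cong refl) (simp add: algebra_simps)
  then have Z0: "(\<Sum>k<l. monom 1 k * (al k ^ r + de k ^ r * f ^ (w + 1))) = 0"
    using gg(3) by simp
  define G where "G = (\<Sum>k<l. monom 1 (k * r) * (al k + de k * f ^ (w + 1)))"
  obtain k where k: "k < l" "g k \<noteq> g' k"
    using gg(1,2,4) unfolding D_def by (metis PiE_ext lessThan_iff)
  have "\<not> (al k = 0 \<and> de k = 0)"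
    using k(2) by (auto simp: al_def de_def prod_eq_iff)
  then have "G \<noteq> 0"
    using stepanov_independence[OF char(1-4) f(2-5), of l al de k] deg k(1) unfolding G_def by blast
  have degG: "Polynomial.degree G \<le> r * (w + q) + w + q * r"
    unfolding G_def
  proof (rule degree_sum_le)
    fix k assume "k \<in> {..<l}"
    then have "k < l" by simp
    have "Polynomial.degree (de k * f ^ (w + 1)) \<le> (w - q) + 2 * q * (w + 1)"
    proof -
      have "Polynomial.degree (f ^ (w + 1)) \<le> 2 * q * (w + 1)"
        using degree_power_le[of "f" "w + 1"] mult_le_mono1[OF f(2)] le_trans by blast
      then show ?thesis
        using degree_mult_le[of "de k" "f ^ (w + 1)"] deg(2)[OF \<open>k < l\<close>] by linarith
    qed
    also have "\<dots> = w + q * r"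
      using char(4) unfolding char(3) by (simp add: algebra_simps)
    finally have "Polynomial.degree (al k + de k * f ^ (w + 1)) \<le> w + q * r"
      using deg(1)[OF \<open>k < l\<close>] by (intro degree_add_le) auto
    moreover have "Polynomial.degree (monom (1::'a) (k * r)) \<le> k * r"
      by (rule degree_monom_le)
    moreover have "k * r \<le> r * (w + q)"
      using \<open>k < l\<close> by (simp add: l_def mult.commute)
    ultimately show "Polynomial.degree (monom 1 (k * r) * (al k + de k * f ^ (w + 1))) \<le> r * (w + q) + w + q * r"
      using degree_mult_le[of "monom 1 (k * r)" "al k + de k * f ^ (w + 1)"] by linarith
  qed simp
  have "poly G x = 0" if x: "x ^ (r * r) = x" "poly f x ^ (2 * w * (w + 1)) = 1" for x
  proof -
    \<comment> \<open>In other words \<open>(w + 1) r = (r^2 - 1) / 2 + (w + 1)\<close>: at a point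
      where \<open>f\<close> is a nonzero square, \<open>f ^ (w + 1)\<close> is unchanged by the
      \<open>r\<close>-th power.\<close>
    have exp: "(w + 1) * r = 2 * w * (w + 1) + (w + 1)"
      unfolding char(3) by (simp add: algebra_simps)
    have fx: "(poly f x ^ (w + 1)) ^ r = poly f x ^ (w + 1)"
    proof -
      have "(poly f x ^ (w + 1)) ^ r = poly f x ^ (2 * w * (w + 1) + (w + 1))"
        by (subst power_mult[symmetric], subst exp) (rule refl)
      also have "\<dots> = poly f x ^ (w + 1)"
        by (subst power_add, subst x(2)) (rule mult_1_left)
      finally show ?thesis .
    qed
    have xk: "(x ^ (k * r)) ^ r = x ^ k" for k
      by (metis power_mult mult.commute mult.assoc x(1))
    have "poly G x ^ r = (\<Sum>k<l. x ^ (k * r) * (poly (al k) x + poly (de k) x * poly f x ^ (w + 1))) ^ r"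
      by (simp add: G_def poly_sum poly_monom)
    also have "\<dots> = (\<Sum>k<l. (x ^ (k * r) * (poly (al k) x + poly (de k) x * poly f x ^ (w + 1))) ^ r)"
      using freshmans_dream_sum'[OF char(1,2)] by simp
    also have "\<dots> = (\<Sum>k<l. x ^ k * (poly (al k) x ^ r + poly (de k) x ^ r * poly f x ^ (w + 1)))"
      using freshmans_dream'[OF char(1,2)] by (intro sum.cong refl) (simp only: power_mult_distrib xk fx)
    also have "\<dots> = poly (\<Sum>k<l. monom 1 k * (al k ^ r + de k ^ r * f ^ (w + 1))) x"
      by (simp add: poly_sum poly_monom)
    finally show ?thesis
      using Z0 r by simp
  qed
  then have "card {x. x ^ (r * r) = x \<and> poly f x ^ (2 * w * (w + 1)) = 1} \<le> card {x. poly G x = 0}"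
    using \<open>G \<noteq> 0\<close> by (intro card_mono poly_roots_finite) auto
  also have "\<dots> \<le> Polynomial.degree G"
    using \<open>G \<noteq> 0\<close> by (rule card_poly_roots_bound)
  finally show ?thesis
    using degG by linarith
qed

section \<open>Kloosterman sums in towers of quadratic extensions\<close>

lemma sum_fibres:
  fixes h :: "'b \<Rightarrow> complex"
  assumes "finite A" "finite B" "g ` A \<subseteq> B"
  shows "(\<Sum>x\<in>A. h (g x)) = (\<Sum>y\<in>B. of_nat (card {x\<in>A. g x = y}) * h y)"
proof -
  have "(\<Sum>x\<in>A. h (g x)) = (\<Sum>y\<in>B. \<Sum>x\<in>{x\<in>A. g x = y}. h (g x))"
    using sum.group[OF assms, of "\<lambda>x. h (g x)"] by simp
  also have "\<dots> = (\<Sum>y\<in>B. of_nat (card {x\<in>A. g x = y}) * h y)"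
    by (intro sum.cong refl) simp
  finally show ?thesis .
qed

text \<open>All fields of the tower are subsets of one algebraically closed type, so a level is just
  a number \<open>j\<close> and elements of the next level arise as roots of explicit polynomials.
  The assumptions on \<open>\<psi>\<close> concern only the base field, the fixed set of
  \<open>x ^ q\<close>.\<close>

locale kloosterman_tower =
  fixes q e :: nat and a b :: "'a::alg_closed_field" and \<psi> :: "'a \<Rightarrow> complex"
  assumes prime: "prime CHAR('a)" and odd: "odd q"
    and q: "q = CHAR('a) ^ e" "e > 0"
    and ab: "a \<noteq> 0" "b \<noteq> 0" "a ^ q = a" "b ^ q = b"
    and char_add: "\<And>x y. x ^ q = x \<Longrightarrow> y ^ q = y \<Longrightarrow> \<psi> (x + y) = \<psi> x * \<psi> y"
    and char_norm: "\<And>x. x ^ q = x \<Longrightarrow> norm (\<psi> x) = 1"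
    and char_nontrivial: "\<exists>x. x ^ q = x \<and> \<psi> x \<noteq> 1"
begin

section \<open>Levels of the tower and lifted characters\<close>

definition lev :: "nat \<Rightarrow> nat" where "lev j = q ^ (2 ^ j)"

definition F :: "nat \<Rightarrow> 'a set" where "F j = {x. x ^ lev j = x}"

primrec chi :: "nat \<Rightarrow> 'a \<Rightarrow> complex" where
  "chi 0 x = \<psi> x"
| "chi (Suc j) x = chi j (x + x ^ lev j)"

definition kl :: "nat \<Rightarrow> complex" where
  "kl j = (\<Sum>s\<in>F j - {0}. chi j (a * s + b / s))"

lemma lev_0: "lev 0 = q" and lev_Suc: "lev (Suc j) = lev j * lev j"
  by (simp_all add: lev_def power_mult power2_eq_square mult.commute[of 2])

lemma lev_char: "lev j = CHAR('a) ^ (e * 2 ^ j)"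
  unfolding lev_def power_mult by (simp only: q(1)[symmetric])

lemma q_ge_3: "q \<ge> 3"
proof -
  have "q > 1"
    using q prime_gt_1_nat[OF prime] one_less_power by blast
  moreover have "q \<noteq> 2"
    using odd by auto
  ultimately show ?thesis by simp
qed

lemma odd_lev: "odd (lev j)"
  using odd by (simp add: lev_def)

lemma q_le_lev: "q \<le> lev j"
  using q_ge_3 by (simp add: lev_def self_le_power)

lemma lev_ge_3: "lev j \<ge> 3"
  using q_le_lev q_ge_3 le_trans by blast

lemma two_nonzero: "(2::'a) \<noteq> 0"
proof -
  have "\<not> CHAR('a) dvd 2"
    using odd q prime by (metis even_power primes_dvd_imp_eq two_is_prime_nat dvd_refl)
  then show ?thesis
    using of_nat_eq_0_iff_char_dvd[where 'a = 'a, of 2] by simp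
qed

lemma pow_lev_add: "(x + y :: 'a) ^ lev j = x ^ lev j + y ^ lev j"
  and pow_lev_diff: "(x - y :: 'a) ^ lev j = x ^ lev j - y ^ lev j"
  using freshmans_dream'[OF prime lev_char] CHAR_power_diff[OF prime lev_char] by auto

lemma pow_q_add: "(x + y :: 'a) ^ q = x ^ q + y ^ q"
  using pow_lev_add[of _ _ 0] by (simp add: lev_0)

lemma pow_lev_Suc: "(x::'a) ^ lev (Suc j) = (x ^ lev j) ^ lev j"
  by (simp add: lev_Suc power_mult)

lemma subring_F: "subring_set (F j)"
  unfolding F_def by (rule subring_set_fixed[OF prime lev_char])

lemma F_closed [simp]:
  "0 \<in> F j" "1 \<in> F j" "x \<in> F j \<Longrightarrow> y \<in> F j \<Longrightarrow> x + y \<in> F j"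
  "x \<in> F j \<Longrightarrow> y \<in> F j \<Longrightarrow> x - y \<in> F j" "x \<in> F j \<Longrightarrow> y \<in> F j \<Longrightarrow> x * y \<in> F j"
  using subring_F[of j] by (auto simp: subring_set_def)

lemma F_divide [simp]: "x \<in> F j \<Longrightarrow> y \<in> F j \<Longrightarrow> x / y \<in> F j"
  by (simp add: F_def power_divide)

lemma F_uminus [simp]: "x \<in> F j \<Longrightarrow> - x \<in> F j"
  using F_closed(4)[of 0 j x] by simp

lemma F_power [simp]: "x \<in> F j \<Longrightarrow> x ^ k \<in> F j"
  by (induction k) auto

lemma card_F: "card (F j) = lev j"
  unfolding F_def using card_frobenius_fixed[OF prime lev_char] q by simp

lemma finite_F [simp]: "finite (F j)"
  using card_F[of j] lev_ge_3[of j] by (intro card_ge_0_finite) simp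

lemma F_Suc: "x \<in> F j \<Longrightarrow> x \<in> F (Suc j)"
  by (simp add: F_def pow_lev_Suc)

lemma ab_F [simp]: "a \<in> F j" "b \<in> F j"
proof -
  have "a \<in> F j \<and> b \<in> F j"
    by (induction j) (auto simp: ab lev_0 F_def[of 0] intro: F_Suc)
  then show "a \<in> F j" "b \<in> F j" by auto
qed

lemma trace_norm_F:
  assumes "x \<in> F (Suc j)"
  shows "x + x ^ lev j \<in> F j" "x * x ^ lev j \<in> F j"
  using assms by (auto simp: F_def pow_lev_add pow_lev_Suc power_mult_distrib)

text \<open>\<open>x + x ^ lev j\<close> is the relative trace between consecutive levels. It is
  additive, lands in \<open>F j\<close> and commutes with \<open>x ^ q\<close>, so each property
  passes up the tower. The last one makes \<open>chi j\<close> trivial on the elements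
  \<open>x ^ q - x\<close>.\<close>

lemma chi_props:
  "(x \<in> F j \<longrightarrow> y \<in> F j \<longrightarrow> chi j (x + y) = chi j x * chi j y)
    \<and> (x \<in> F j \<longrightarrow> norm (chi j x) = 1) \<and> (x \<in> F j \<longrightarrow> chi j (x ^ q) = chi j x)"
proof (induction j arbitrary: x y)
  case 0
  then show ?case
    using char_add char_norm by (auto simp: F_def lev_0)
next
  case (Suc j)
  have "chi (Suc j) (x + y) = chi (Suc j) x * chi (Suc j) y" if "x \<in> F (Suc j)" "y \<in> F (Suc j)"
  proof -
    have "x + y + (x + y) ^ lev j = (x + x ^ lev j) + (y + y ^ lev j)"
      by (simp add: pow_lev_add)
    then show ?thesis
      using Suc trace_norm_F(1) that by (simp only: chi.simps)
  qed
  moreover have "chi (Suc j) (x ^ q) = chi (Suc j) x" if "x \<in> F (Suc j)"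
  proof -
    have "x ^ q + (x ^ q) ^ lev j = (x + x ^ lev j) ^ q"
      by (simp add: pow_q_add mult.commute flip: power_mult)
    then show ?thesis
      using Suc trace_norm_F(1) that by simp
  qed
  ultimately show ?case
    using Suc trace_norm_F(1) by simp
qed

lemma chi_add: "x \<in> F j \<Longrightarrow> y \<in> F j \<Longrightarrow> chi j (x + y) = chi j x * chi j y"
  and chi_norm: "x \<in> F j \<Longrightarrow> norm (chi j x) = 1"
  and chi_frobenius: "x \<in> F j \<Longrightarrow> chi j (x ^ q) = chi j x"
  using chi_props by blast+

text \<open>A root of \<open>X^Q + X - t\<close>, with \<open>Q = lev j\<close>, satisfies
  \<open>x^Q = t - x\<close>; raising to the power \<open>Q\<close> once more returns
  \<open>x\<close>, so the root lies in the next level.\<close>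

lemma trace_surj:
  assumes "t \<in> F j"
  shows "\<exists>x\<in>F (Suc j). x + x ^ lev j = t"
proof -
  define p where "p = monom 1 (lev j) + [:-t, 1:]"
  have "Polynomial.degree p = lev j"
    unfolding p_def using lev_ge_3[of j] by (subst degree_add_eq_left) (auto simp: degree_monom_eq)
  then obtain x where "poly p x = 0"
    using alg_closed_imp_poly_has_root[of p] lev_ge_3[of j] by auto
  then have x: "x ^ lev j = t - x"
    by (simp add: p_def poly_monom algebra_simps eq_neg_iff_add_eq_0)
  have "(x ^ lev j) ^ lev j = t - x ^ lev j"
    unfolding x pow_lev_diff using assms x by (simp add: F_def)
  then have "x \<in> F (Suc j)"
    using x by (simp add: F_def pow_lev_Suc)
  then show ?thesis
    using x by (intro bexI[of _ x]) auto
qed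

lemma chi_nontrivial: "\<exists>x\<in>F j. chi j x \<noteq> 1"
proof (induction j)
  case 0
  then show ?case
    using char_nontrivial by (auto simp: F_def lev_0)
next
  case (Suc j)
  then show ?case
    using trace_surj by (metis chi.simps(2))
qed

lemma sum_chi:
  assumes "y \<in> F j"
  shows "(\<Sum>x\<in>F j. chi j (x * y)) = (if y = 0 then of_nat (lev j) else 0)"
proof (cases "y = 0")
  case True
  have "chi j 0 * chi j 0 = chi j 0" "norm (chi j 0) = 1"
    using chi_add[of 0 j 0] chi_norm[of 0 j] by auto
  then have "chi j 0 = 1"
    by auto
  then show ?thesis
    using True by (simp add: card_F)
next
  case False
  obtain z where z: "z \<in> F j" "chi j z \<noteq> 1"
    using chi_nontrivial by blast
  have "(\<Sum>x\<in>F j. chi j (x * y)) = (\<Sum>x\<in>F j. chi j (x * y + z))"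
    by (rule sum.reindex_bij_witness[of _ "\<lambda>x. x + z / y" "\<lambda>x. x - z / y"])
      (use False z assms in \<open>auto simp: field_simps\<close>)
  also have "\<dots> = (\<Sum>x\<in>F j. chi j (x * y)) * chi j z"
    unfolding sum_distrib_right using z assms by (intro sum.cong refl chi_add) auto
  finally show ?thesis
    using False z(2) by simp
qed

text \<open>The roots of \<open>X\<^sup>2 - tX + u\<close> either both lie in the base field or are conjugate over it.\<close>

lemma card_trace_norm_fibres:
  assumes "t \<in> F j" "u \<in> F j" "u \<noteq> 0"
  shows "card {z \<in> (F j - {0}) \<times> (F j - {0}). (fst z + snd z, fst z * snd z) = (t, u)}
    + card {s \<in> F (Suc j) - {0}. (s + s ^ lev j, s * s ^ lev j) = (t, u)} = 2"
    (is "card ?P + card ?S = 2")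
proof -
  obtain x where "poly [:u, -t, 1:] x = 0"
    using alg_closed_imp_poly_has_root[of "[:u, -t, 1:]"] by auto
  then have x: "x * (t - x) = u"
    by (simp add: algebra_simps)
  define y where "y = t - x"
  have xy: "x + y = t" "x * y = u" "x \<noteq> 0" "y \<noteq> 0"
    using x assms(3) by (auto simp: y_def)
  have roots: "s = x \<or> s = y" if "s * (t - s) = u" for s
  proof -
    have "(s - x) * (s - y) = 0"
      using that unfolding xy(1)[symmetric] xy(2)[symmetric] by (simp add: algebra_simps)
    then show ?thesis by simp
  qed
  have "(x * (t - x)) ^ lev j = u ^ lev j"
    by (simp only: x)
  then have "x ^ lev j * (t - x ^ lev j) = u"
    using assms by (simp add: power_mult_distrib pow_lev_diff F_def)
  then have "x ^ lev j = x \<or> x ^ lev j = y"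
    by (rule roots)
  then consider "x ^ lev j = x" | "x ^ lev j = y" "x \<noteq> y" by blast
  then show ?thesis
  proof cases
    case 1
    then have F: "x \<in> F j" "y \<in> F j"
      using assms by (auto simp: F_def y_def pow_lev_diff)
    have P: "?P = {(x, y), (y, x)}"
    proof
      show "?P \<subseteq> {(x, y), (y, x)}"
      proof
        fix z assume z: "z \<in> ?P"
        then have sz: "snd z = t - fst z" "fst z * snd z = u" by (auto simp: algebra_simps)
        then have "fst z = x \<or> fst z = y"
          using roots by simp
        then show "z \<in> {(x, y), (y, x)}"
          using sz xy(1) by (cases z) auto
      qed
    qed (use F xy in \<open>auto simp: add.commute mult.commute\<close>)
    have fixed: "x ^ lev j = x" "y ^ lev j = y"
      using F by (auto simp: F_def)
    \<comment> \<open>For a double root both fibres contribute one: the pair \<open>(x, x)\<close>,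
      and \<open>x\<close> itself as an element equal to its own conjugate.\<close>
    have S: "?S = (if x = y then {x} else {})"
    proof -
      have "x = y \<and> s = x" if s: "s \<in> ?S" for s
      proof -
        have s': "s ^ lev j = t - s" "s * s ^ lev j = u"
          using s by (auto simp: algebra_simps)
        then have "s = x \<or> s = y"
          using roots by simp
        then show ?thesis
          using s'(1) fixed xy(1) by (auto simp: algebra_simps)
      qed
      moreover have "x \<in> ?S" if "x = y"
        using that F xy fixed F_Suc by auto
      ultimately show ?thesis by auto
    qed
    show ?thesis
      unfolding P S by auto
  next
    case 2
    have y: "y ^ lev j = x"
      using assms(1) 2 xy(1) by (simp add: y_def pow_lev_diff F_def)
    have F: "x \<in> F (Suc j)" "y \<in> F (Suc j)"
      using 2 y by (auto simp: F_def pow_lev_Suc)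
    have nF: "x \<notin> F j" "y \<notin> F j"
      using 2 y by (auto simp: F_def)
    have P: "?P = {}"
    proof -
      have False if z: "z \<in> ?P" for z
      proof -
        have "snd z = t - fst z" "fst z * snd z = u" "fst z \<in> F j"
          using z by (auto simp: algebra_simps)
        then show False
          using roots[of "fst z"] nF by auto
      qed
      then show ?thesis by blast
    qed
    have S: "?S = {x, y}"
    proof
      show "?S \<subseteq> {x, y}"
      proof
        fix s assume "s \<in> ?S"
        then have "s ^ lev j = t - s" "s * s ^ lev j = u"
          by (auto simp: algebra_simps)
        then show "s \<in> {x, y}"
          using roots by simp
      qed
    qed (use F xy y 2 in \<open>auto simp: add.commute mult.commute\<close>)
    show ?thesis
      unfolding P S using 2 by simp
  qed
qed

text \<open>The quadratic case of the Hasse-Davenport relation for Kloosterman sums.\<close>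

lemma kl_Suc: "kl (Suc j) = 2 * of_nat (lev j) - (kl j)\<^sup>2"
proof -
  define B where "B = F j \<times> (F j - {0})"
  \<comment> \<open>Since \<open>1/s + 1/s' = (s + s') / (s * s')\<close>, the summand at a pair, or
    at an element together with its conjugate, depends only on the sum \<open>t\<close> and the
    product \<open>u\<close>.\<close>
  define h where "h = (\<lambda>(t, u). chi j (a * t + b * t / u))"
  define gP where "gP z = (fst z + snd z, fst z * snd z)" for z :: "'a \<times> 'a"
  define gS where "gS s = (s + s ^ lev j, s * s ^ lev j)" for s :: 'a
  define P where "P = (F j - {0}) \<times> (F j - {0})"
  define S where "S = F (Suc j) - {0}"
  have "(kl j)\<^sup>2 = (\<Sum>z\<in>P. chi j (a * fst z + b / fst z) * chi j (a * snd z + b / snd z))"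
    unfolding P_def kl_def power2_eq_square sum_product sum.cartesian_product
    by (simp add: case_prod_unfold)
  also have "\<dots> = (\<Sum>z\<in>P. h (gP z))"
  proof (intro sum.cong refl)
    fix z assume z: "z \<in> P"
    then have "chi j (a * fst z + b / fst z) * chi j (a * snd z + b / snd z)
        = chi j ((a * fst z + b / fst z) + (a * snd z + b / snd z))"
      by (subst chi_add) (auto simp: P_def)
    also have "(a * fst z + b / fst z) + (a * snd z + b / snd z)
        = a * (fst z + snd z) + b * (fst z + snd z) / (fst z * snd z)"
    proof -
      have "1 / fst z + 1 / snd z = (fst z + snd z) / (fst z * snd z)"
        using z by (subst add_frac_eq) (auto simp: P_def add.commute)
      then have "b * (1 / fst z + 1 / snd z) = b * ((fst z + snd z) / (fst z * snd z))"
        by (simp only:)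
      then show ?thesis
        by (simp add: distrib_left)
    qed
    finally show "chi j (a * fst z + b / fst z) * chi j (a * snd z + b / snd z) = h (gP z)"
      by (simp add: h_def gP_def)
  qed
  also have "\<dots> = (\<Sum>y\<in>B. of_nat (card {z\<in>P. gP z = y}) * h y)"
    by (rule sum_fibres) (auto simp: P_def B_def gP_def)
  finally have 1: "(kl j)\<^sup>2 = (\<Sum>y\<in>B. of_nat (card {z\<in>P. gP z = y}) * h y)" .
  have "kl (Suc j) = (\<Sum>s\<in>S. h (gS s))"
    unfolding kl_def S_def
  proof (intro sum.cong refl)
    fix s assume s: "s \<in> F (Suc j) - {0}"
    have "(a * s + b / s) + (a * s + b / s) ^ lev j = a * s + b / s + (a * s ^ lev j + b / s ^ lev j)"
      using ab_F[of j] by (simp add: pow_lev_add power_mult_distrib power_divide F_def)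
    also have "\<dots> = a * (s + s ^ lev j) + b * (s + s ^ lev j) / (s * s ^ lev j)"
    proof -
      have "1 / s + 1 / s ^ lev j = (s + s ^ lev j) / (s * s ^ lev j)"
        using s by (subst add_frac_eq) (auto simp: add.commute)
      then have "b * (1 / s + 1 / s ^ lev j) = b * ((s + s ^ lev j) / (s * s ^ lev j))"
        by (simp only:)
      then show ?thesis
        by (simp add: distrib_left)
    qed
    finally show "chi (Suc j) (a * s + b / s) = h (gS s)"
      by (simp add: h_def gS_def)
  qed
  also have "\<dots> = (\<Sum>y\<in>B. of_nat (card {s\<in>S. gS s = y}) * h y)"
    using trace_norm_F by (intro sum_fibres) (auto simp: S_def B_def gS_def)
  finally have 2: "kl (Suc j) = (\<Sum>y\<in>B. of_nat (card {s\<in>S. gS s = y}) * h y)" .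
  have "(kl j)\<^sup>2 + kl (Suc j)
      = (\<Sum>y\<in>B. of_nat (card {z\<in>P. gP z = y} + card {s\<in>S. gS s = y}) * h y)"
    unfolding 1 2 by (simp add: sum.distrib[symmetric] distrib_right)
  also have "\<dots> = (\<Sum>y\<in>B. 2 * h y)"
  proof (intro sum.cong refl)
    fix y assume "y \<in> B"
    then obtain t u where y: "y = (t, u)" "t \<in> F j" "u \<in> F j" "u \<noteq> 0"
      by (auto simp: B_def)
    show "of_nat (card {z\<in>P. gP z = y} + card {s\<in>S. gS s = y}) * h y = 2 * h y"
      using card_trace_norm_fibres[OF y(2-4)] unfolding P_def S_def gP_def gS_def y(1) by simp
  qed
  \<comment> \<open>For fixed norm \<open>u\<close> the exponent is linear in the trace
    \<open>t\<close>; by orthogonality only \<open>u = - (b / a)\<close> survives, contributing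
    \<open>lev j\<close>.\<close>
  also have "\<dots> = 2 * (\<Sum>u\<in>F j - {0}. \<Sum>t\<in>F j. chi j (t * (a + b / u)))"
    unfolding B_def sum_distrib_left[symmetric] sum.cartesian_product[symmetric] h_def
    by (subst sum.swap) (simp add: algebra_simps)
  also have "(\<Sum>u\<in>F j - {0}. \<Sum>t\<in>F j. chi j (t * (a + b / u)))
      = (\<Sum>u\<in>F j - {0}. if u = - (b / a) then of_nat (lev j) else 0)"
  proof (intro sum.cong refl)
    fix u assume u: "u \<in> F j - {0}"
    have "a + b / u = 0 \<longleftrightarrow> u = - (b / a)"
    proof -
      have "a + b / u = (a / u) * (u - (- (b / a)))"
        using u ab by (simp add: distrib_left)
      then show ?thesis
        using u ab by (simp add: eq_neg_iff_add_eq_0)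
    qed
    then show "(\<Sum>t\<in>F j. chi j (t * (a + b / u))) = (if u = - (b / a) then of_nat (lev j) else 0)"
      using u sum_chi[of "a + b / u" j] by simp
  qed
  also have "\<dots> = of_nat (lev j)"
    using ab by (simp add: sum.delta)
  finally show ?thesis
    by (simp add: algebra_simps eq_diff_eq)
qed


section \<open>Points on the curves \<open>a s + b/s = x^q - x + c\<close>\<close>

definition npts :: "nat \<Rightarrow> 'a \<Rightarrow> nat" where
  "npts j c = card {z \<in> F j \<times> (F j - {0}). a * snd z + b / snd z - fst z ^ q + fst z = c}"

lemma card_quadratic: "card {s. s \<noteq> 0 \<and> a * s + b / s = v} \<le> 2"
proof -
  have "{s. s \<noteq> 0 \<and> a * s + b / s = v} \<subseteq> {s. poly [:b, -v, a:] s = 0}"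
    by (auto simp: field_simps)
  then have "card {s. s \<noteq> 0 \<and> a * s + b / s = v} \<le> card {s. poly [:b, -v, a:] s = 0}"
    using ab by (intro card_mono poly_roots_finite) auto
  also have "\<dots> \<le> Polynomial.degree [:b, -v, a:]"
    using ab by (intro card_poly_roots_bound) auto
  also have "\<dots> = 2"
    using ab by simp
  finally show ?thesis .
qed

text \<open>It is enough to control the first coordinates: for given \<open>x\<close> the equation
  is quadratic in \<open>s\<close>.\<close>

lemma npts_le_card:
  assumes W: "finite W" "\<And>x s. x \<in> F j \<Longrightarrow> s \<in> F j \<Longrightarrow> s \<noteq> 0 \<Longrightarrow> a * s + b / s = x ^ q - x + c \<Longrightarrow> x \<in> W"
  shows "npts j c \<le> 2 * card W"
proof -
  define N where "N = {z \<in> F j \<times> (F j - {0}). a * snd z + b / snd z - fst z ^ q + fst z = c}"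
  have eq: "a * s + b / s = x ^ q - x + c" if "(x, s) \<in> N" for x s
    using that by (auto simp: N_def)
  have "N \<subseteq> (SIGMA x:W. {s. s \<noteq> 0 \<and> a * s + b / s = x ^ q - x + c})"
  proof
    fix z assume z: "z \<in> N"
    have "fst z \<in> F j" "snd z \<in> F j" "snd z \<noteq> 0"
      using z by (auto simp: N_def)
    moreover have "a * snd z + b / snd z = fst z ^ q - fst z + c"
      using eq[of "fst z" "snd z"] z by simp
    ultimately have "fst z \<in> W"
      by (rule W(2))
    then show "z \<in> (SIGMA x:W. {s. s \<noteq> 0 \<and> a * s + b / s = x ^ q - x + c})"
      using \<open>snd z \<noteq> 0\<close> \<open>a * snd z + b / snd z = _\<close> by (cases z) simp
  qed
  moreover have fin: "finite {s. s \<noteq> 0 \<and> a * s + b / s = v}" for v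
  proof (rule finite_subset)
    show "{s. s \<noteq> 0 \<and> a * s + b / s = v} \<subseteq> {s. poly [:b, -v, a:] s = 0}"
      by (auto simp: field_simps)
    show "finite {s. poly [:b, -v, a:] s = 0}"
      using ab by (intro poly_roots_finite) auto
  qed
  ultimately have "card N \<le> card (SIGMA x:W. {s. s \<noteq> 0 \<and> a * s + b / s = x ^ q - x + c})"
    using W(1) by (intro card_mono) auto
  also have "\<dots> = (\<Sum>x\<in>W. card {s. s \<noteq> 0 \<and> a * s + b / s = x ^ q - x + c})"
    using W(1) fin by simp
  also have "\<dots> \<le> (\<Sum>x\<in>W. 2)"
    by (intro sum_mono card_quadratic)
  finally show ?thesis
    by (simp add: npts_def N_def mult.commute)
qed

lemma npts_trivial: "npts j c \<le> 2 * lev j"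
  using npts_le_card[of "F j" j c] by (simp add: card_F)

text \<open>Eliminate \<open>s\<close>: \<open>(a s - b/s)^2 = (a s + b/s)^2 - 4ab\<close>, so at a
  point of the curve the polynomial \<open>f\<close> is zero or a nonzero square. Its constant term
  \<open>c^2 - 4ab\<close> explains the excluded \<open>c\<close>, and \<open>j >= 1\<close> yields
  \<open>q^2 <= lev j\<close>, hence \<open>q <= w\<close>.\<close>

lemma npts_upper:
  assumes c: "c \<in> F (Suc j)" "c\<^sup>2 \<noteq> 4 * a * b" and j: "j \<ge> 1"
  shows "npts (Suc j) c \<le> lev (Suc j) + 8 * q * lev j"
proof -
  define r where "r = lev j"
  obtain w where w: "r = 2 * w + 1"
    using odd_lev r_def oddE by blast
  have "q * q \<le> r"
    unfolding r_def lev_def using j power_increasing[of "2::nat" "2 ^ j" q] q_ge_3 self_le_power[of 2 j]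
    by (simp add: power2_eq_square)
  moreover have "3 * q \<le> q * q"
    using q_ge_3 by (rule mult_le_mono1)
  ultimately have qw: "q \<le> w"
    using w q_ge_3 by linarith
  define h where "h = monom 1 q - monom 1 1 + [:c:]"
  define f where "f = h * h - [:4 * a * b:]"
  have hx: "poly h x = x ^ q - x + c" for x
    by (simp add: h_def poly_monom)
  have fx: "poly f x = (x ^ q - x + c)\<^sup>2 - 4 * a * b" for x
    by (simp add: f_def hx power2_eq_square)
  have charr: "r = CHAR('a) ^ (e * 2 ^ j)"
    unfolding r_def by (rule lev_char)
  have rr: "lev (Suc j) = r * r"
    by (simp add: lev_Suc r_def)
  have coeffs: "coeffs_in {x. x ^ (r * r) = x} f"
  proof -
    have "coeffs_in (F (Suc j)) [:v:]" if "v \<in> F (Suc j)" for v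
      using coeffs_in_closed(6)[OF subring_F that, of 0] by (simp add: monom_0)
    moreover have "4 * a * b = (1 + 1) * (1 + 1) * a * b"
      by simp
    then have "4 * a * b \<in> F (Suc j)"
      by (simp only: F_closed ab_F)
    ultimately have "coeffs_in (F (Suc j)) f"
      unfolding f_def h_def using c by (intro coeffs_in_closed subring_F) auto
    then show ?thesis
      by (simp add: F_def rr)
  qed
  have degh: "Polynomial.degree (h - [:v:]) = q" for v
  proof -
    have "h - [:v:] = monom 1 q + [:c - v, -1:]"
      by (simp add: h_def monom_altdef)
    moreover have "Polynomial.degree (monom (1::'a) q + [:c - v, -1:]) = q"
      using q_ge_3 by (subst degree_add_eq_left) (auto simp: degree_monom_eq)
    ultimately show ?thesis by simp
  qed
  have degf: "Polynomial.degree f \<le> 2 * q"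
    unfolding f_def
  proof (rule degree_diff_le)
    show "Polynomial.degree (h * h) \<le> 2 * q"
      using degree_mult_le[of h h] degh[of 0] by simp
  qed simp
  have f0: "poly f 0 \<noteq> 0"
    using c(2) q_ge_3 by (simp add: fx power_0_left)
  \<comment> \<open>The simple root comes from \<open>f = (h - v)(h + v)\<close>: as
    \<open>h\<close> has derivative -1, the derivative of \<open>f\<close> at a zero of
    \<open>h - v\<close> is \<open>-2v\<close>, which is nonzero in odd characteristic.\<close>
  obtain v where v: "v ^ 2 = 4 * a * b"
    using nth_root_exists[of 2 "4 * a * b"] by auto
  obtain z where z: "poly (h - [:v:]) z = 0"
    using alg_closed_imp_poly_has_root[of "h - [:v:]"] degh[of v] q_ge_3 by auto
  then have hz: "poly h z = v"
    by simp
  then have fz: "poly f z = 0"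
    using v by (simp add: f_def power2_eq_square)
  have "v \<noteq> 0"
  proof
    assume "v = 0"
    then have "2 * 2 * a * b = 0"
      using v by simp
    then show False
      using ab two_nonzero by (simp only: mult_eq_0_iff) simp
  qed
  have "of_nat q = (0::'a)"
    using q CHAR_power_eq_0 by blast
  then have "poly (pderiv h) z = - 1"
    by (simp add: h_def pderiv_add pderiv_diff pderiv_monom poly_monom pderiv_pCons)
  then have "poly (pderiv f) z = - (2 * v)"
    by (simp add: f_def pderiv_diff pderiv_mult hz pderiv_pCons)
  then have fz': "poly (pderiv f) z \<noteq> 0"
    using \<open>v \<noteq> 0\<close> two_nonzero by simp
  have stepanov: "card {x. x ^ (r * r) = x \<and> poly f x ^ (2 * w * (w + 1)) = 1} \<le> r * (w + q) + w + q * r"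
    using stepanov_bound[OF prime charr w qw _ coeffs degf f0 fz fz'] q by simp
  define W where "W = {x. x ^ (r * r) = x \<and> poly f x ^ (2 * w * (w + 1)) = 1} \<union> {x. poly f x = 0}"
  have finX: "finite W"
  proof -
    have "{x. x ^ (r * r) = x \<and> poly f x ^ (2 * w * (w + 1)) = 1} \<subseteq> F (Suc j)"
      by (auto simp: F_def rr)
    moreover have "finite {x. poly f x = 0}"
      using f0 by (intro poly_roots_finite) auto
    ultimately show ?thesis
      unfolding W_def using finite_subset finite_F by blast
  qed
  have "npts (Suc j) c \<le> 2 * card W"
  proof (rule npts_le_card[OF finX])
    fix x s assume x: "x \<in> F (Suc j)" and s: "s \<in> F (Suc j)" "s \<noteq> 0" and eq: "a * s + b / s = x ^ q - x + c"
    define y where "y = a * s - b / s"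
    have "(a * s + b / s)\<^sup>2 - 4 * a * b = y\<^sup>2"
      using s(2) by (simp add: y_def power2_eq_square algebra_simps)
    then have fy: "poly f x = y\<^sup>2"
      by (simp add: fx eq)
    show "x \<in> W"
    proof (cases "y = 0")
      case True
      then show ?thesis
        using fy by (simp add: W_def)
    next
      case False
      have "y \<in> F (Suc j)"
        using s by (simp add: y_def)
      then have "y ^ (r * r) = y"
        by (simp add: F_def rr)
      moreover have "r * r = Suc (2 * (2 * w * (w + 1)))"
        unfolding w by (simp add: algebra_simps)
      ultimately have "y * (y\<^sup>2) ^ (2 * w * (w + 1)) = y * 1"
        by (simp only: power_mult[symmetric] power_Suc[symmetric]) simp
      then have "poly f x ^ (2 * w * (w + 1)) = 1"
        using False fy by (metis mult_left_cancel)
      then show ?thesis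
        using x by (simp add: W_def F_def rr)
    qed
  qed
  also have "card W \<le> (r * (w + q) + w + q * r) + 2 * q"
  proof -
    have "card {x. poly f x = 0} \<le> 2 * q"
      using card_poly_roots_bound[of f] degf f0 by fastforce
    then show ?thesis
      unfolding W_def using stepanov card_Un_le[of "{x. x ^ (r * r) = x \<and> poly f x ^ (2 * w * (w + 1)) = 1}" "{x. poly f x = 0}"]
      by linarith
  qed
  \<comment> \<open>Here \<open>2rw + 2w = r^2 - 1\<close>, and the remaining
    \<open>4qr + 4q\<close> is at most \<open>8qr\<close>.\<close>
  also have "2 * ((r * (w + q) + w + q * r) + 2 * q) \<le> r * r + 8 * q * r"
  proof -
    have "r * r = 2 * (r * w) + r"
      by (subst (2) w) (simp add: algebra_simps)
    moreover have "q * 1 \<le> q * r"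
      using lev_ge_3[of j] by (intro mult_le_mono2) (simp add: r_def)
    ultimately show ?thesis
      using w by (simp add: algebra_simps)
  qed
  finally show ?thesis
    by (simp add: rr r_def)
qed

lemma sum_npts: "(\<Sum>c\<in>F j. of_nat (npts j c) * h c)
    = (\<Sum>z\<in>F j \<times> (F j - {0}). h (a * snd z + b / snd z - fst z ^ q + fst z) :: complex)"
  unfolding npts_def by (subst sum_fibres[where B = "F j"]) auto

text \<open>Each pair \<open>(x, s)\<close> lies on the curve of exactly one \<open>c\<close>, and
  \<open>chi j\<close> ignores \<open>x ^ q - x\<close>; so the pair has weight
  \<open>chi j (a * s + b / s)\<close>, and each \<open>s\<close> occurs with all
  \<open>lev j\<close> values of \<open>x\<close>.\<close>

lemma kl_npts: "of_nat (lev j) * kl j = (\<Sum>c\<in>F j. of_nat (npts j c) * chi j c)"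
proof -
  have "(\<Sum>c\<in>F j. of_nat (npts j c) * chi j c) = (\<Sum>z\<in>F j \<times> (F j - {0}). chi j (a * snd z + b / snd z))"
    unfolding sum_npts
  proof (intro sum.cong refl)
    fix z assume z: "z \<in> F j \<times> (F j - {0})"
    have "chi j (a * snd z + b / snd z) * chi j (fst z) = chi j (a * snd z + b / snd z + fst z)"
      using z by (subst chi_add) auto
    also have "a * snd z + b / snd z + fst z = (a * snd z + b / snd z - fst z ^ q + fst z) + fst z ^ q"
      by simp
    also have "chi j \<dots> = chi j (a * snd z + b / snd z - fst z ^ q + fst z) * chi j (fst z ^ q)"
      using z by (subst chi_add) auto
    also have "chi j (fst z ^ q) = chi j (fst z)"
      using z by (auto intro: chi_frobenius)
    finally show "chi j (a * snd z + b / snd z - fst z ^ q + fst z) = chi j (a * snd z + b / snd z)"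
      using chi_norm[of "fst z" j] z by auto
  qed
  also have "\<dots> = (\<Sum>x\<in>F j. kl j)"
    unfolding kl_def sum.cartesian_product by (simp add: case_prod_unfold)
  finally show ?thesis
    by (simp add: card_F)
qed

lemma sum_npts_total: "(\<Sum>c\<in>F j. real (npts j c)) = real (lev j) * (real (lev j) - 1)"
proof -
  have "card (F j - {0}) = lev j - 1"
    by (simp add: card_F card_Diff_singleton)
  then have "(\<Sum>c\<in>F j. complex_of_nat (npts j c)) = of_nat (lev j * (lev j - 1))"
    using sum_npts[of j "\<lambda>_. 1"] by (simp add: card_F)
  then have "complex_of_nat (\<Sum>c\<in>F j. npts j c) = of_nat (lev j * (lev j - 1))"
    by simp
  then have "(\<Sum>c\<in>F j. npts j c) = lev j * (lev j - 1)"
    by (rule of_nat_eq_iff[THEN iffD1])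
  then have "real (\<Sum>c\<in>F j. npts j c) = real (lev j) * real (lev j - 1)"
    by simp
  then show ?thesis
    using lev_ge_3[of j] by (simp add: of_nat_diff)
qed

text \<open>One-sided point counts are enough, because the average over \<open>c\<close> is known.\<close>

lemma kl_bound:
  assumes "j \<ge> 1"
  shows "norm (kl (Suc j)) \<le> 21 * real q * real (lev j)"
proof -
  define Q where "Q = real (lev (Suc j))"
  define C where "C = 8 * real q * real (lev j)"
  have "Q > 0"
    using lev_ge_3[of "Suc j"] by (simp add: Q_def)
  \<comment> \<open>At the exceptional \<open>c\<close> the trivial bound \<open>2Q\<close> leaves
    an excess of at most \<open>Q\<close>.\<close>
  have pos: "max (real (npts (Suc j) c) - Q) 0 \<le> C + (if c\<^sup>2 = 4 * a * b then Q else 0)" if c: "c \<in> F (Suc j)" for c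
  proof (cases "c\<^sup>2 = 4 * a * b")
    case True
    have "real (npts (Suc j) c) \<le> 2 * Q"
      using npts_trivial[of "Suc j" c] by (simp add: Q_def)
    moreover have "0 \<le> C"
      by (simp add: C_def)
    ultimately show ?thesis
      using True \<open>Q > 0\<close> by simp
  next
    case False
    have "real (npts (Suc j) c) \<le> real (lev (Suc j) + 8 * q * lev j)"
      using npts_upper[OF c False assms] of_nat_le_iff by blast
    then show ?thesis
      using False by (simp add: C_def Q_def)
  qed
  have "card {c \<in> F (Suc j). c\<^sup>2 = 4 * a * b} \<le> 2"
  proof -
    have "card {c \<in> F (Suc j). c\<^sup>2 = 4 * a * b} \<le> card {c. poly [:- (4 * a * b), 0, 1:] c = 0}"
      by (intro card_mono poly_roots_finite) (auto simp: power2_eq_square)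
    also have "\<dots> \<le> Polynomial.degree [:- (4 * a * b), 0, 1:]"
      by (intro card_poly_roots_bound) auto
    finally show ?thesis by simp
  qed
  then have exc: "(\<Sum>c\<in>F (Suc j). if c\<^sup>2 = 4 * a * b then Q else 0) \<le> 2 * Q"
    using \<open>Q > 0\<close> by (simp add: sum.If_cases Int_def)
  \<comment> \<open>Subtracting the constant \<open>Q\<close> from every count is free, because the
    character sums to zero.\<close>
  have "(\<Sum>c\<in>F (Suc j). of_nat (npts (Suc j) c) * chi (Suc j) c)
      = (\<Sum>c\<in>F (Suc j). of_real (real (npts (Suc j) c) - Q) * chi (Suc j) c)"
    using sum_chi[of 1 "Suc j"] by (simp del: chi.simps add: left_diff_distrib sum_subtractf sum_distrib_left[symmetric])
  then have "of_nat (lev (Suc j)) * kl (Suc j)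
      = (\<Sum>c\<in>F (Suc j). of_real (real (npts (Suc j) c) - Q) * chi (Suc j) c)"
    unfolding kl_npts .
  from arg_cong[OF this, of norm]
  have "Q * norm (kl (Suc j)) = norm (\<Sum>c\<in>F (Suc j). of_real (real (npts (Suc j) c) - Q) * chi (Suc j) c)"
    by (simp add: norm_mult Q_def del: chi.simps of_real_diff)
  also have "\<dots> \<le> (\<Sum>c\<in>F (Suc j). \<bar>real (npts (Suc j) c) - Q\<bar>)"
    by (rule sum_norm_le) (simp add: norm_mult chi_norm del: of_real_diff chi.simps)
  \<comment> \<open>From \<open>|y| = 2 max(y, 0) - y\<close>. The deviations \<open>y\<close> add
    up to \<open>Q(Q - 1) - Q^2 = -Q\<close>, so only their positive parts need an estimate.\<close>
  also have "\<dots> = (\<Sum>c\<in>F (Suc j). 2 * max (real (npts (Suc j) c) - Q) 0 - (real (npts (Suc j) c) - Q))"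
    by (intro sum.cong refl) (auto simp: max_def)
  also have "\<dots> = 2 * (\<Sum>c\<in>F (Suc j). max (real (npts (Suc j) c) - Q) 0) + Q"
    by (simp add: sum_subtractf sum_distrib_left[symmetric] sum.distrib sum_npts_total card_F Q_def algebra_simps)
  also have "(\<Sum>c\<in>F (Suc j). max (real (npts (Suc j) c) - Q) 0)
      \<le> (\<Sum>c\<in>F (Suc j). C + (if c\<^sup>2 = 4 * a * b then Q else 0))"
    using pos by (rule sum_mono)
  also have "\<dots> \<le> Q * C + 2 * Q"
    using exc by (simp add: sum.distrib card_F Q_def)
  finally have "Q * norm (kl (Suc j)) \<le> Q * (2 * C + 5)"
    by (simp add: algebra_simps)
  then have "norm (kl (Suc j)) \<le> 2 * C + 5"
    using \<open>Q > 0\<close> by simp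
  \<comment> \<open>21 = 2 * 8 + 5, where 5 = 2 * 2 + 1 collects the two exceptional
    \<open>c\<close> and the mean deviation.\<close>
  also have "\<dots> \<le> 21 * real q * real (lev j)"
  proof -
    have "1 * 1 \<le> real q * real (lev j)"
      using q_ge_3 lev_ge_3[of j] by (intro mult_mono) auto
    then show ?thesis
      by (simp add: C_def)
  qed
  finally show ?thesis .
qed

theorem weil_bound: "norm (kl 0) \<le> 2 * sqrt (real q)"
proof (rule ccontr)
  assume "\<not> norm (kl 0) \<le> 2 * sqrt (real q)"
  define A where "A j = norm (kl j) / sqrt (real (lev j))" for j
  have pos: "real (lev j) > 0" for j
    using lev_ge_3[of j] by simp
  have "A 0 > 2"
    using \<open>\<not> norm (kl 0) \<le> _\<close> pos[of 0] by (simp add: A_def lev_0 field_simps)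
  define d where "d = A 0 - 2"
  have step: "A (Suc j) \<ge> (A j)\<^sup>2 - 2" for j
  proof -
    have "norm ((kl j)\<^sup>2) - norm (2 * of_nat (lev j) :: complex) \<le> norm (kl (Suc j))"
      unfolding kl_Suc
      using norm_triangle_ineq2[of "(kl j)\<^sup>2" "2 * of_nat (lev j)"] norm_minus_commute[of "(kl j)\<^sup>2"] by simp
    then have "(norm (kl j))\<^sup>2 - 2 * real (lev j) \<le> norm (kl (Suc j))"
      by (simp add: norm_mult norm_power)
    then have "((norm (kl j))\<^sup>2 - 2 * real (lev j)) / real (lev j) \<le> norm (kl (Suc j)) / real (lev j)"
      using pos[of j] by (intro divide_right_mono) auto
    moreover have "((norm (kl j))\<^sup>2 - 2 * real (lev j)) / real (lev j) = (A j)\<^sup>2 - 2"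
      using pos[of j] by (simp add: A_def power_divide diff_divide_distrib)
    moreover have "norm (kl (Suc j)) / real (lev j) = A (Suc j)"
      by (simp add: A_def lev_Suc real_sqrt_mult)
    ultimately show ?thesis by simp
  qed
  \<comment> \<open>The excess over 2 at least quadruples at each level:
    \<open>(2 + x)^2 - 2 >= 2 + 4x\<close>.\<close>
  have "A j \<ge> 2 + 4 ^ j * d" for j
  proof (induction j)
    case (Suc j)
    have "d > 0" using \<open>A 0 > 2\<close> by (simp add: d_def)
    then have "(2 + 4 ^ j * d)\<^sup>2 \<le> (A j)\<^sup>2"
      using Suc by (intro power_mono) auto
    moreover have "(2 + 4 ^ j * d)\<^sup>2 = 4 + 4 * (4 ^ j * d) + (4 ^ j * d)\<^sup>2"
      by (simp add: power2_eq_square algebra_simps)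
    ultimately have "2 + 4 * (4 ^ j * d) \<le> (A j)\<^sup>2 - 2"
      by (smt (verit) zero_le_power2)
    then show ?case
      using step[of j] by simp
  qed (simp add: d_def)
  note lower = this
  have upper: "A (Suc j) \<le> 21 * real q" if "j \<ge> 1" for j
    using kl_bound[OF that] pos[of j] by (simp add: A_def lev_Suc real_sqrt_mult field_simps)
  obtain j where "21 * real q / d < 4 ^ j"
    using real_arch_pow[of 4] by auto
  have "2 + 4 ^ Suc (Suc j) * d \<le> 21 * real q"
    using lower[of "Suc (Suc j)"] upper[of "Suc j"] by simp
  moreover have "21 * real q < 4 ^ j * d"
    using \<open>21 * real q / d < 4 ^ j\<close> \<open>A 0 > 2\<close> by (simp add: d_def field_simps)
  moreover have "4 ^ j * d \<le> 4 ^ Suc (Suc j) * d"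
    using \<open>A 0 > 2\<close> by (intro mult_right_mono power_increasing) (auto simp: d_def)
  ultimately show False
    by linarith
qed

end

section \<open>Additive characters of finite fields\<close>

lemma prime_CHAR_finite: "prime CHAR('k::{field,finite})"
  by (rule prime_CHAR_semidom) (simp add: finite_imp_CHAR_pos)

definition char_on :: "'k::{field,finite} set \<Rightarrow> ('k \<Rightarrow> complex) \<Rightarrow> bool" where
  "char_on H \<psi> \<longleftrightarrow> 0 \<in> H \<and> (\<forall>x\<in>H. \<forall>y\<in>H. x + y \<in> H \<and> \<psi> (x + y) = \<psi> x * \<psi> y)
     \<and> (\<forall>x\<in>H. norm (\<psi> x) = 1)"

lemma char_on_of_nat_mult: "char_on H \<psi> \<Longrightarrow> h \<in> H \<Longrightarrow> of_nat n * h \<in> H"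
  by (induction n) (auto simp: char_on_def distrib_right)

text \<open>In characteristic \<open>p\<close> the inverse of \<open>h\<close> is
  \<open>(p - 1) h\<close>, so closure under addition already makes \<open>H\<close> a
  subgroup.\<close>

lemma char_on_diff:
  fixes g h :: "'k::{field,finite}"
  assumes "char_on H \<psi>" "g \<in> H" "h \<in> H"
  shows "g - h \<in> H"
proof -
  have "CHAR('k) > 0"
    by (simp add: finite_imp_CHAR_pos)
  then have "of_nat (CHAR('k) - 1) * h = - h"
    by (simp add: of_nat_diff Suc_le_eq)
  then have "- h \<in> H"
    using char_on_of_nat_mult[OF assms(1,3)] by metis
  then show ?thesis
    using assms unfolding char_on_def by (metis diff_conv_add_uminus)
qed

text \<open>\<open>H\<close> grows to its direct sum with the multiples of \<open>x\<close>; since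
  \<open>p x = 0\<close>, any \<open>p\<close>-th root of unity may be prescribed at
  \<open>x\<close>.\<close>

lemma char_on_extend:
  fixes H :: "'k::{field,finite} set" and w :: complex
  assumes \<psi>: "char_on H \<psi>" and x: "x \<notin> H" and w: "w ^ CHAR('k) = 1" "norm w = 1"
  shows "\<exists>H' \<psi>'. char_on H' \<psi>' \<and> card H' = CHAR('k) * card H \<and> x \<in> H' \<and> \<psi>' x = w"
proof -
  define p where "p = CHAR('k)"
  have p: "prime p"
    unfolding p_def by (rule prime_CHAR_finite)
  then have p1: "p > 1"
    by (rule prime_gt_1_nat)
  have p0: "of_nat p = (0::'k)"
    by (simp add: p_def)
  define f where "f = (\<lambda>(h, j). h + of_nat j * x)"
  define D where "D = H \<times> {..<p}"
  \<comment> \<open>Directness of the sum: \<open>m\<close> is invertible modulo \<open>p\<close>,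
    so \<open>x\<close> is a multiple of \<open>m x\<close> and would lie in
    \<open>H\<close>.\<close>
  have no_mult: "of_nat m * x \<notin> H" if m: "0 < m" "m < p" for m
  proof
    assume mx: "of_nat m * x \<in> H"
    have "\<not> p dvd m"
      using m nat_dvd_not_less by blast
    then have "gcd m p = 1"
      using p by (metis coprime_commute coprime_iff_gcd_eq_1 prime_imp_coprime)
    then obtain k y where "m * k = p * y + 1"
      using bezout_nat[of m p] m by auto
    then have eq: "of_nat k * (of_nat m * x) = x"
      using p0 by (metis (no_types, lifting) add_0 mult.assoc mult.commute mult_zero_left mult_1 of_nat_1 of_nat_add of_nat_mult)
    show False
      using char_on_of_nat_mult[OF \<psi> mx, of k] x unfolding eq by simp
  qed
  have inj: "inj_on f D"
  proof (rule inj_onI)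
    fix y z assume yz: "y \<in> D" "z \<in> D" "f y = f z"
    have le: False if "fst y' \<in> H" "fst z' \<in> H" "snd y' < snd z'" "snd z' < p" "f y' = f z'" for y' z'
    proof -
      have "of_nat (snd z' - snd y') * x = fst y' - fst z'"
        using that by (simp add: f_def case_prod_unfold of_nat_diff algebra_simps)
      then show False
        using no_mult[of "snd z' - snd y'"] char_on_diff[OF \<psi> that(1,2)] that(3,4)
        by (metis less_imp_diff_less zero_less_diff)
    qed
    have "snd y = snd z"
      using le[of y z] le[of z y] yz unfolding D_def
      by (metis SigmaE fst_conv lessThan_iff linorder_neqE_nat snd_conv)
    then show "y = z"
      using yz(3) by (simp add: f_def case_prod_unfold prod_eq_iff)
  qed
  define \<psi>' where "\<psi>' y = (case inv_into D f y of (h, j) \<Rightarrow> \<psi> h * w ^ j)" for y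
  \<comment> \<open>Both the element and its value depend on \<open>j\<close> only modulo
    \<open>p\<close>, so adding two exponents needs no discussion of carries.\<close>
  have red: "h + of_nat j * x = f (h, j mod p)" "w ^ j = w ^ (j mod p)" for h j
  proof -
    have "of_nat j = (of_nat (j mod p + p * (j div p)) :: 'k)"
      by simp
    then have "of_nat j = (of_nat (j mod p) :: 'k)"
      using p0 by (simp only: of_nat_add of_nat_mult) simp
    then show "h + of_nat j * x = f (h, j mod p)"
      by (simp add: f_def)
    have "w ^ j = w ^ (j mod p + p * (j div p))"
      by simp
    then show "w ^ j = w ^ (j mod p)"
      using w(1) by (simp only: power_add power_mult p_def[symmetric]) simp
  qed
  have mem: "h + of_nat j * x \<in> f ` D" and val: "\<psi>' (h + of_nat j * x) = \<psi> h * w ^ j" if "h \<in> H" for h j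
  proof -
    have "(h, j mod p) \<in> D"
      using that p1 by (simp add: D_def)
    then have "h + of_nat j * x \<in> f ` D" "\<psi>' (h + of_nat j * x) = \<psi> h * w ^ (j mod p)"
      unfolding red(1) \<psi>'_def using inj by auto
    then show "h + of_nat j * x \<in> f ` D" "\<psi>' (h + of_nat j * x) = \<psi> h * w ^ j"
      by (simp_all only: red(2)[symmetric])
  qed
  have H0: "0 \<in> H"
    using \<psi> by (simp add: char_on_def)
  have "\<psi> 0 * \<psi> 0 = \<psi> 0" "norm (\<psi> 0) = 1"
    using \<psi> unfolding char_on_def by (metis add_0, blast)
  then have \<psi>0: "\<psi> 0 = 1"
    by auto
  have "char_on (f ` D) \<psi>'"
    unfolding char_on_def
  proof (intro conjI ballI)
    show "0 \<in> f ` D"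
      using mem[OF H0, of 0] by simp
  next
    fix y z assume "y \<in> f ` D" "z \<in> f ` D"
    then obtain g i h j where gh: "y = g + of_nat i * x" "z = h + of_nat j * x" "g \<in> H" "h \<in> H"
      by (auto simp: f_def D_def)
    then have sum: "y + z = (g + h) + of_nat (i + j) * x" "g + h \<in> H" "\<psi> (g + h) = \<psi> g * \<psi> h"
      using \<psi> by (auto simp: char_on_def algebra_simps)
    show "y + z \<in> f ` D"
      unfolding sum(1) using sum(2) by (rule mem)
    show "\<psi>' (y + z) = \<psi>' y * \<psi>' z"
    proof -
      have "\<psi>' (y + z) = \<psi> (g + h) * w ^ (i + j)"
        by (subst sum(1)) (rule val[OF sum(2)])
      moreover have "\<psi>' y = \<psi> g * w ^ i" "\<psi>' z = \<psi> h * w ^ j"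
        using val[OF gh(3)] val[OF gh(4)] gh(1,2) by simp_all
      ultimately show ?thesis
        by (simp add: sum(3) power_add)
    qed
  next
    fix y assume "y \<in> f ` D"
    then obtain g i where "y = g + of_nat i * x" "g \<in> H"
      by (auto simp: f_def D_def)
    then show "norm (\<psi>' y) = 1"
      using val \<psi> w(2) by (simp add: norm_mult norm_power char_on_def)
  qed
  moreover have "card (f ` D) = p * card H"
    using inj by (simp add: card_image D_def card_cartesian_product)
  moreover have "x \<in> f ` D" "\<psi>' x = w"
    using mem[OF H0, of 1] val[OF H0, of 1] \<psi>0 by auto
  ultimately show ?thesis
    unfolding p_def by blast
qed

text \<open>One maximality argument serves both claims: a subgroup of largest size carrying such a
  character must be everything, since an extension would multiply its size by the
  characteristic.\<close>

lemma CARD_power_CHAR_and_char_exists: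
  "\<exists>e \<psi>. CARD('k::{field,finite}) = CHAR('k) ^ e \<and> e > 0 \<and> char_on (UNIV :: 'k set) \<psi> \<and> (\<exists>x. \<psi> x \<noteq> 1)"
proof -
  define w where "w = cis (2 * pi / CHAR('k))"
  have p1: "CHAR('k) > 1"
    using prime_CHAR_finite prime_gt_1_nat by blast
  have "w ^ CHAR('k) = cis (real CHAR('k) * (2 * pi / real CHAR('k)))"
    unfolding w_def by (rule Complex.DeMoivre)
  also have "\<dots> = 1"
    using p1 by simp
  finally have w: "w ^ CHAR('k) = 1" "norm w = 1"
    by (simp_all add: w_def)
  have "w \<noteq> 1"
  proof
    assume "w = 1"
    then have "cos (2 * pi / CHAR('k)) = 1"
      unfolding w_def by (metis cis.simps(1) one_complex.simps(1))
    then obtain n :: int where "2 * pi / CHAR('k) = of_int n * 2 * pi"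
      using cos_one_2pi_int by blast
    then have "of_int n * real CHAR('k) = 1"
      using p1 by (simp add: field_simps)
    then have "n * int CHAR('k) = 1"
      by (metis of_int_1 of_int_eq_iff of_int_mult of_int_of_nat_eq)
    then have "int CHAR('k) dvd 1"
      by (metis dvd_triv_right)
    then show False
      using p1 by simp
  qed
  \<comment> \<open>The starting group \<open>{0}\<close> has only the trivial character, so
    nontriviality is required for \<open>e > 0\<close> alone; each extension supplies it through the
    value \<open>w\<close> at the new element.\<close>
  define good where "good H \<longleftrightarrow> (\<exists>\<psi> e. char_on H \<psi> \<and> card H = CHAR('k) ^ e \<and> (e > 0 \<longrightarrow> (\<exists>x\<in>H. \<psi> x \<noteq> 1)))"
    for H :: "'k set"
  have "char_on {0::'k} (\<lambda>_. 1)"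
    by (simp add: char_on_def)
  then have good0: "good {0}"
    unfolding good_def by (intro exI[of _ "\<lambda>_. 1"] exI[of _ 0]) simp
  have "\<forall>H. good H \<longrightarrow> card H < Suc CARD('k)"
    by (simp add: card_mono less_Suc_eq_le)
  from ex_has_greatest_nat[OF good0 this]
  obtain H where H: "good H" "\<And>H'. good H' \<Longrightarrow> card H' \<le> card H"
    by metis
  obtain \<psi> e where \<psi>: "char_on H \<psi>" "card H = CHAR('k) ^ e" "e > 0 \<longrightarrow> (\<exists>x\<in>H. \<psi> x \<noteq> 1)"
    using H(1) unfolding good_def by blast
  have "H = UNIV"
  proof (rule ccontr)
    assume "H \<noteq> UNIV"
    then obtain x where "x \<notin> H" by blast
    then obtain H' \<psi>' where H': "char_on H' \<psi>'" "card H' = CHAR('k) * card H" "x \<in> H'" "\<psi>' x = w"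
      using char_on_extend[OF \<psi>(1) _ w] by blast
    then have "good H'"
      unfolding good_def using \<open>w \<noteq> 1\<close> \<psi>(2) by (intro exI[of _ \<psi>'] exI[of _ "Suc e"]) auto
    then have "CHAR('k) * card H \<le> card H"
      using H(2) H'(2) by metis
    then show False
      using p1 \<psi>(2) by simp
  qed
  moreover have "e > 0"
  proof (rule ccontr)
    assume "\<not> e > 0"
    then have "card (UNIV :: 'k set) = 1"
      using \<psi>(2) \<open>H = UNIV\<close> by simp
    then show False
      by (metis card_1_singletonE singletonD UNIV_I zero_neq_one)
  qed
  ultimately show ?thesis
    using \<psi> by blast
qed

lemma power_CARD_eq_same: "(x::'k::{field,finite}) ^ CARD('k) = x"
proof (cases "x = 0")
  case False
  have "(\<Prod>y\<in>UNIV - {0}. x * y) = (\<Prod>y\<in>UNIV - {0::'k}. y)"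
    by (rule prod.reindex_bij_witness[of _ "\<lambda>y. y / x" "\<lambda>y. x * y"]) (use False in auto)
  then have "x ^ (CARD('k) - 1) * (\<Prod>y\<in>UNIV - {0}. y) = 1 * (\<Prod>y\<in>UNIV - {0::'k}. y)"
    by (simp add: prod.distrib card_Diff_singleton)
  then have "x ^ (CARD('k) - 1) = 1"
    by (subst (asm) mult_right_cancel) (auto simp: prod_zero_iff)
  then have "x ^ Suc (CARD('k) - 1) = x"
    by (simp only: power_Suc mult_1_right)
  moreover have "Suc (CARD('k) - 1) = CARD('k)"
    by (simp add: card_gt_0_iff)
  ultimately show ?thesis
    by (simp only:)
qed (simp add: card_gt_0_iff)

locale finite_field_char =
  fixes \<psi> :: "'k::{field,finite} \<Rightarrow> complex"
  assumes odd_card: "odd CARD('k)"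
    and add: "\<psi> (x + y) = \<psi> x * \<psi> y"
    and norm [simp]: "norm (\<psi> x) = 1"
    and nontrivial: "\<exists>x. \<psi> x \<noteq> 1"
begin

text \<open>The image of \<open>'k\<close> in its algebraic closure is contained in the fixed set of
  \<open>x ^ CARD('k)\<close> and has equally many elements, so it is level 0 of the tower.\<close>

lemma weil_kloosterman:
  assumes "a \<noteq> 0" "b \<noteq> 0"
  shows "norm (\<Sum>s\<in>UNIV - {0}. \<psi> (a * s + b / s)) \<le> 2 * sqrt (real CARD('k))"
proof -
  obtain e where e: "CARD('k) = CHAR('k) ^ e" "e > 0"
    using CARD_power_CHAR_and_char_exists[where 'k = 'k] by blast
  have pow: "to_ac x ^ CARD('k) = to_ac x" for x :: 'k
    by (metis power_CARD_eq_same to_ac_power)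
  have prime: "prime CHAR('k alg_closure)"
    by (simp add: prime_CHAR_finite)
  have "card {x :: 'k alg_closure. x ^ CARD('k) = x} = CARD('k)"
    using card_frobenius_fixed[OF prime] e by simp
  moreover have "card (range (to_ac :: 'k \<Rightarrow> _)) = CARD('k)"
    using inj_to_ac by (rule card_image)
  ultimately have fixed: "{x :: 'k alg_closure. x ^ CARD('k) = x} = range to_ac"
    using pow by (intro card_subset_eq[symmetric] card_ge_0_finite) (auto simp: card_gt_0_iff)
  interpret kloosterman_tower "CARD('k)" e "to_ac a" "to_ac b" "\<lambda>x. \<psi> (of_ac x)"
  proof
    show "prime CHAR('k alg_closure)" by (rule prime)
    show "odd CARD('k)" by (rule odd_card)
    show "CARD('k) = CHAR('k alg_closure) ^ e" "e > 0" using e by simp_all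
    show "to_ac a \<noteq> 0" "to_ac b \<noteq> 0" using assms by simp_all
    show "to_ac a ^ CARD('k) = to_ac a" "to_ac b ^ CARD('k) = to_ac b" by (rule pow)+
    fix x y :: "'k alg_closure"
    assume "x ^ CARD('k) = x"
    then have x: "x \<in> range to_ac"
      using fixed by blast
    then show "norm (\<psi> (of_ac x)) = 1" by simp
    assume "y ^ CARD('k) = y"
    then have "y \<in> range to_ac"
      using fixed by blast
    with x show "\<psi> (of_ac (x + y)) = \<psi> (of_ac x) * \<psi> (of_ac y)"
      by (metis add of_ac_to_ac rangeE to_ac_add)
  next
    obtain x where "\<psi> x \<noteq> 1"
      using nontrivial by blast
    then show "\<exists>x. x ^ CARD('k) = x \<and> \<psi> (of_ac x) \<noteq> 1"
      using pow by (intro exI[of _ "to_ac x"]) simp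
  qed
  have "F 0 - {0} = to_ac ` (UNIV - {0})"
    using fixed by (auto simp: F_def lev_0)
  then have "kl 0 = (\<Sum>s\<in>UNIV - {0}. \<psi> (a * s + b / s))"
    unfolding kl_def by (simp add: sum.reindex inj_on_subset[OF inj_to_ac] flip: to_ac_mult to_ac_divide to_ac_add)
  then show ?thesis
    using weil_bound by simp
qed

end

section \<open>Gauss, Kloosterman and Salie sums\<close>

lemma sum_prod_vec:
  fixes f :: "'d::finite \<Rightarrow> 'k::finite \<Rightarrow> complex"
  shows "(\<Sum>x\<in>(UNIV :: ('k ^ 'd) set). \<Prod>j\<in>UNIV. f j (x $ j)) = (\<Prod>j\<in>UNIV. \<Sum>y\<in>UNIV. f j y)"
proof -
  have "(\<Prod>j\<in>UNIV. \<Sum>y\<in>UNIV. f j y) = (\<Sum>g\<in>PiE UNIV (\<lambda>_. UNIV). \<Prod>j\<in>UNIV. f j (g j))"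
    by (rule prod_sum_PiE) auto
  also have "\<dots> = (\<Sum>x\<in>(UNIV :: ('k ^ 'd) set). \<Prod>j\<in>UNIV. f j (x $ j))"
    by (rule sum.reindex_bij_witness[of _ vec_nth vec_lambda]) auto
  finally show ?thesis ..
qed

definition dot :: "'k::comm_ring_1 ^ 'd::finite \<Rightarrow> 'k ^ 'd \<Rightarrow> 'k" where
  "dot x y = (\<Sum>j\<in>UNIV. x $ j * y $ j)"

lemma dot_diff_right: "dot x (y - z) = dot x y - dot x z"
  by (simp add: dot_def algebra_simps sum_subtractf)

context finite_field_char
begin

lemma psi_0 [simp]: "\<psi> 0 = 1"
proof -
  have "\<psi> 0 * \<psi> 0 = \<psi> 0"
    using add[of 0 0] by simp
  moreover have "\<psi> 0 \<noteq> 0"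
    using norm[of 0] by force
  ultimately show ?thesis by simp
qed

lemma psi_nonzero [simp]: "\<psi> x \<noteq> 0"
  using norm[of x] by force

lemma psi_minus: "\<psi> (- x) = cnj (\<psi> x)"
proof -
  have "\<psi> x * \<psi> (- x) = 1"
    using add[of x "- x"] by simp
  moreover have "\<psi> x * cnj (\<psi> x) = 1"
    by (simp add: complex_norm_square[symmetric])
  ultimately show ?thesis
    by (metis mult_left_cancel psi_nonzero)
qed

lemma psi_diff: "\<psi> (x - y) = \<psi> x * cnj (\<psi> y)"
  using add[of x "- y"] by (simp add: psi_minus)

lemma psi_sum: "\<psi> (\<Sum>j\<in>J. f j) = (\<Prod>j\<in>J. \<psi> (f j))"
  by (induction J rule: infinite_finite_induct) (auto simp: add)

lemma sum_psi: "(\<Sum>x\<in>UNIV. \<psi> (x * y)) = (if y = 0 then of_nat CARD('k) else 0)"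
proof (cases "y = 0")
  case False
  obtain z where z: "\<psi> z \<noteq> 1"
    using nontrivial by blast
  have "(\<Sum>x\<in>UNIV. \<psi> (x * y)) = (\<Sum>x\<in>UNIV. \<psi> (x * y + z))"
    by (rule sum.reindex_bij_witness[of _ "\<lambda>x. x + z / y" "\<lambda>x. x - z / y"])
      (use False in \<open>auto simp: field_simps\<close>)
  also have "\<dots> = (\<Sum>x\<in>UNIV. \<psi> (x * y)) * \<psi> z"
    by (simp add: add sum_distrib_right)
  finally show ?thesis
    using False z by simp
qed simp

lemma sum_psi_nonzero: "(\<Sum>s\<in>UNIV - {0}. \<psi> (s * y)) = (if y = 0 then of_nat CARD('k) else 0) - 1"
  using sum_psi[of y] by (simp add: sum_diff1)

lemma two_nonzero: "(2::'k) \<noteq> 0"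
proof -
  obtain e where "CARD('k) = CHAR('k) ^ e" "e > 0"
    using CARD_power_CHAR_and_char_exists[where 'k = 'k] by blast
  then have "\<not> CHAR('k) dvd 2"
    using odd_card prime_CHAR_finite[where 'k = 'k]
    by (metis even_power primes_dvd_imp_eq two_is_prime_nat dvd_refl)
  then show ?thesis
    using of_nat_eq_0_iff_char_dvd[where 'a = 'k, of 2] by simp
qed

lemma four_nonzero: "(4::'k) \<noteq> 0"
proof -
  have "(4::'k) = 2 * 2" by simp
  then show ?thesis
    using two_nonzero by (metis mult_eq_0_iff)
qed

section \<open>Quadratic Gauss sums and the quadratic character\<close>

definition G :: "'k \<Rightarrow> complex" where "G s = (\<Sum>x\<in>UNIV. \<psi> (s * x\<^sup>2))"

lemma G_linear:
  assumes "s \<noteq> 0"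
  shows "(\<Sum>x\<in>UNIV. \<psi> (s * x\<^sup>2 + c * x)) = \<psi> (- c\<^sup>2 / (4 * s)) * G s"
proof -
  have "(\<Sum>x\<in>UNIV. \<psi> (s * x\<^sup>2 + c * x)) = (\<Sum>x\<in>UNIV. \<psi> (- c\<^sup>2 / (4 * s) + s * x\<^sup>2))"
  proof (rule sum.reindex_bij_witness[of _ "\<lambda>x. x - c / (2 * s)" "\<lambda>x. x + c / (2 * s)"])
    fix x
    have "s * (x + c / (2 * s))\<^sup>2 = s * x\<^sup>2 + c * x + c\<^sup>2 / (4 * s)"
      using assms two_nonzero four_nonzero by (simp add: field_simps power2_eq_square)
    then show "\<psi> (- c\<^sup>2 / (4 * s) + s * (x + c / (2 * s))\<^sup>2) = \<psi> (s * x\<^sup>2 + c * x)"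
      by simp
  qed auto
  then show ?thesis
    by (simp only: add sum_distrib_left G_def)
qed

text \<open>In the double sum for the squared modulus the substitution \<open>x = u + y\<close>
  makes the exponent linear in \<open>y\<close>, and summing over \<open>y\<close> leaves only
  \<open>u = 0\<close>.\<close>

lemma norm_G:
  assumes "s \<noteq> 0"
  shows "norm (G s) = sqrt (real CARD('k))"
proof -
  have "G s * cnj (G s) = (\<Sum>y\<in>UNIV. \<Sum>x\<in>UNIV. \<psi> (s * x\<^sup>2 - s * y\<^sup>2))"
    unfolding G_def cnj_sum sum_product psi_diff by (rule sum.swap)
  also have "\<dots> = (\<Sum>y\<in>UNIV. \<Sum>u\<in>UNIV. \<psi> (s * u\<^sup>2 + y * (2 * s * u)))"
  proof (rule sum.cong[OF refl])
    fix y
    show "(\<Sum>x\<in>UNIV. \<psi> (s * x\<^sup>2 - s * y\<^sup>2)) = (\<Sum>u\<in>UNIV. \<psi> (s * u\<^sup>2 + y * (2 * s * u)))"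
      by (rule sum.reindex_bij_witness[of _ "\<lambda>u. u + y" "\<lambda>x. x - y"])
        (auto simp: algebra_simps power2_eq_square)
  qed
  also have "\<dots> = (\<Sum>u\<in>UNIV. \<psi> (s * u\<^sup>2) * (\<Sum>y\<in>UNIV. \<psi> (y * (2 * s * u))))"
    by (subst sum.swap) (simp add: add sum_distrib_left)
  also have "\<dots> = (\<Sum>u\<in>(UNIV :: 'k set). if u = 0 then of_nat CARD('k) else 0)"
    unfolding sum_psi using assms two_nonzero by (intro sum.cong) auto
  also have "\<dots> = of_nat CARD('k)"
    by simp
  finally have "complex_of_real ((norm (G s))\<^sup>2) = of_real (real CARD('k))"
    by (simp only: complex_norm_square of_real_of_nat_eq)
  then have "(norm (G s))\<^sup>2 = real CARD('k)"
    by (simp only: of_real_eq_iff)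
  then show ?thesis
    by (metis norm_ge_zero real_sqrt_unique)
qed

definition squares :: "'k set" where "squares = (\<lambda>t. t\<^sup>2) ` (UNIV - {0})"

lemma squares_mult: "x \<in> squares \<Longrightarrow> y \<in> squares \<Longrightarrow> x * y \<in> squares"
  unfolding squares_def by (auto simp flip: power_mult_distrib intro!: imageI)

lemma squares_divide: "x \<in> squares \<Longrightarrow> y \<in> squares \<Longrightarrow> x / y \<in> squares"
  unfolding squares_def by (auto simp flip: power_divide intro!: imageI)

lemma card_sqrt: "v \<in> squares \<Longrightarrow> card {x \<in> UNIV - {0}. x\<^sup>2 = v} = 2"
proof -
  assume "v \<in> squares"
  then obtain t where t: "t \<noteq> 0" "v = t\<^sup>2"
    by (auto simp: squares_def)
  have "{x \<in> UNIV - {0}. x\<^sup>2 = v} = {t, - t}"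
    using t by (auto simp: power2_eq_iff)
  moreover have "t \<noteq> - t"
    using t(1) two_nonzero by (metis add_eq_0_iff mult_2 mult_eq_0_iff)
  ultimately show ?thesis by simp
qed

lemma sum_squares_psi: "G s = 1 + 2 * (\<Sum>v\<in>squares. \<psi> (s * v))"
proof -
  have "G s = 1 + (\<Sum>x\<in>UNIV - {0}. \<psi> (s * x\<^sup>2))"
    unfolding G_def by (simp add: sum.remove[of _ 0])
  also have "(\<Sum>x\<in>UNIV - {0}. \<psi> (s * x\<^sup>2))
      = (\<Sum>v\<in>squares. of_nat (card {x \<in> UNIV - {0}. x\<^sup>2 = v}) * \<psi> (s * v))"
    by (rule sum_fibres[where g = "\<lambda>x. x\<^sup>2" and h = "\<lambda>v. \<psi> (s * v)"]) (auto simp: squares_def)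
  also have "\<dots> = 2 * (\<Sum>v\<in>squares. \<psi> (s * v))"
    by (simp add: card_sqrt[simplified] sum_distrib_left)
  finally show ?thesis .
qed

lemma card_squares: "2 * card squares = CARD('k) - 1"
proof -
  have "complex_of_nat (CARD('k) - 1) = (\<Sum>x\<in>UNIV - {0::'k}. 1)"
    by (simp add: card_Diff_singleton)
  also have "\<dots> = (\<Sum>v\<in>squares. of_nat (card {x \<in> UNIV - {0}. x\<^sup>2 = v}) * 1)"
    by (rule sum_fibres[where g = "\<lambda>x. x\<^sup>2" and h = "\<lambda>v. 1"]) (auto simp: squares_def)
  also have "\<dots> = of_nat (2 * card squares)"
    by (simp add: card_sqrt[simplified])
  finally show ?thesis
    by (simp only: of_nat_eq_iff)
qed

text \<open>The nonzero squares and their multiples by \<open>n\<close> are disjoint, and each set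
  contains half of the nonzero elements.\<close>

lemma nonsquare_coset:
  assumes "n \<noteq> 0" "n \<notin> squares"
  shows "squares \<inter> (\<lambda>v. n * v) ` squares = {}" "squares \<union> (\<lambda>v. n * v) ` squares = UNIV - {0}"
proof -
  show disj: "squares \<inter> (\<lambda>v. n * v) ` squares = {}"
  proof -
    have False if "v \<in> squares" "n * v \<in> squares" for v
    proof -
      have "v \<noteq> 0"
        using that(1) by (auto simp: squares_def)
      then have "n = n * v / v" by simp
      then show False
        using squares_divide[OF that(2,1)] assms(2) by simp
    qed
    then show ?thesis by auto
  qed
  have "card (squares \<union> (\<lambda>v. n * v) ` squares) = card squares + card ((\<lambda>v. n * v) ` squares)"
    using disj by (intro card_Un_disjoint) auto
  also have "card ((\<lambda>v. n * v) ` squares) = card squares"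
    using assms(1) by (intro card_image inj_onI) simp
  finally have "card (squares \<union> (\<lambda>v. n * v) ` squares) = card (UNIV - {0::'k})"
    using card_squares by (simp add: card_Diff_singleton)
  moreover have "squares \<union> (\<lambda>v. n * v) ` squares \<subseteq> UNIV - {0}"
    using assms(1) by (auto simp: squares_def)
  ultimately show "squares \<union> (\<lambda>v. n * v) ` squares = UNIV - {0}"
    by (intro card_subset_eq) auto
qed

text \<open>The quadratic character, except that it takes the value -1 at 0; multiplicativity is
  therefore stated for nonzero arguments.\<close>

definition eta :: "'k \<Rightarrow> complex" where "eta s = (if s \<in> squares then 1 else - 1)"

lemma eta_values: "eta s = 1 \<or> eta s = - 1"
  by (simp add: eta_def)

lemma squares_times_iff:
  assumes "s \<in> squares" "t \<noteq> 0"
  shows "s * t \<in> squares \<longleftrightarrow> t \<in> squares"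
proof
  have "s \<noteq> 0"
    using assms(1) by (auto simp: squares_def)
  then show "s * t \<in> squares \<Longrightarrow> t \<in> squares"
    using squares_divide[of "s * t" s] assms(1) by simp
qed (use assms squares_mult in auto)

lemma eta_mult:
  assumes "s \<noteq> 0" "t \<noteq> 0"
  shows "eta (s * t) = eta s * eta t"
proof -
  have "s * t \<in> squares" if "s \<notin> squares" "t \<notin> squares"
  proof -
    have "t \<in> (\<lambda>v. s * v) ` squares"
      using nonsquare_coset(2)[OF assms(1) that(1)] that(2) assms(2) by blast
    then obtain u where u: "u \<in> squares" "t = s * u"
      by auto
    have "s * s \<in> squares"
      using assms(1) unfolding squares_def power2_eq_square by blast
    then show ?thesis
      using squares_mult[OF _ u(1), of "s * s"] by (simp add: u(2) mult.assoc)
  qed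
  then show ?thesis
    using squares_times_iff[of s t] squares_times_iff[of t s] assms
    by (auto simp: eta_def mult.commute)
qed

text \<open>A square factor is absorbed by rescaling \<open>x\<close>. For a nonsquare
  \<open>s\<close>, the sums over the two cosets of the squares add up to -1, whence
  \<open>G 1 + G s = 0\<close>.\<close>

lemma G_eta:
  assumes "s \<noteq> 0"
  shows "G s = eta s * G 1"
proof (cases "s \<in> squares")
  case True
  then obtain t where t: "t \<noteq> 0" "s = t\<^sup>2"
    by (auto simp: squares_def)
  have "G s = (\<Sum>x\<in>UNIV. \<psi> (1 * x\<^sup>2))"
    unfolding G_def by (rule sum.reindex_bij_witness[of _ "\<lambda>x. x / t" "\<lambda>x. t * x"])
      (use t in \<open>auto simp: power_mult_distrib\<close>)
  then show ?thesis
    using True by (simp add: G_def eta_def)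
next
  case False
  note coset = nonsquare_coset[OF assms False]
  have "(\<Sum>v\<in>squares. \<psi> (s * v)) = (\<Sum>w\<in>(\<lambda>v. s * v) ` squares. \<psi> w)"
    using assms by (subst sum.reindex) (auto intro: inj_onI)
  then have "(\<Sum>v\<in>squares. \<psi> v) + (\<Sum>v\<in>squares. \<psi> (s * v)) = (\<Sum>w\<in>UNIV - {0}. \<psi> w)"
    unfolding coset(2)[symmetric] using coset(1) by (simp add: sum.union_disjoint)
  also have "\<dots> = - 1"
    using sum_psi_nonzero[of 1] by simp
  finally have sum: "(\<Sum>v\<in>squares. \<psi> v) + (\<Sum>v\<in>squares. \<psi> (s * v)) = - 1" .
  have "G 1 + G s = 2 + 2 * ((\<Sum>v\<in>squares. \<psi> v) + (\<Sum>v\<in>squares. \<psi> (s * v)))"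
    unfolding sum_squares_psi[of 1] sum_squares_psi[of s] by simp
  then have "G 1 + G s = 2 + 2 * (- 1)"
    by (simp only: sum)
  then show ?thesis
    using False by (simp add: eta_def eq_neg_iff_add_eq_0 add.commute)
qed

lemma card_roots_square: "card {y. y\<^sup>2 = (c::'k)} \<le> 2"
proof -
  have "card {y. y\<^sup>2 = c} \<le> card {y. poly [:- c, 0, 1:] y = 0}"
    by (intro card_mono poly_roots_finite) (auto simp: power2_eq_square)
  also have "\<dots> \<le> Polynomial.degree [:- c, 0, 1:]"
    by (intro card_poly_roots_bound) auto
  finally show ?thesis by simp
qed

text \<open>The case \<open>b = 0\<close> belongs here because \<open>b\<close> will be a multiple
  of \<open>sqnorm xi\<close>, which vanishes at isotropic frequencies as well as at 0.\<close>

lemma kloosterman_bound: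
  assumes "a \<noteq> 0"
  shows "norm (\<Sum>s\<in>UNIV - {0}. \<psi> (a * s + b / s)) \<le> 2 * sqrt (real CARD('k))"
proof (cases "b = 0")
  case True
  have "CARD('k) \<ge> 1"
    by (simp add: Suc_le_eq card_gt_0_iff)
  then have "1 \<le> sqrt (real CARD('k))"
    by simp
  then have "1 \<le> 2 * sqrt (real CARD('k))"
    by linarith
  then show ?thesis
    using sum_psi_nonzero[of a] assms True by (simp add: mult.commute)
qed (use weil_kloosterman assms in auto)

text \<open>For odd dimensions the Kloosterman sum is replaced by a Salie sum, which completing the
  square evaluates explicitly.\<close>

lemma salie_bound:
  assumes "a \<noteq> 0"
  shows "norm (\<Sum>s\<in>UNIV - {0}. \<psi> (a * s + b / s) * G s) \<le> 2 * real CARD('k)"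
proof (cases "b = 0")
  case True
  have "(\<Sum>s\<in>UNIV - {0}. \<psi> (a * s + b / s) * G s) = (\<Sum>s\<in>UNIV - {0}. \<Sum>x\<in>UNIV. \<psi> (s * (a + x\<^sup>2)))"
    unfolding G_def True by (simp add: sum_distrib_left algebra_simps flip: add)
  also have "\<dots> = (\<Sum>x\<in>UNIV. (if a + x\<^sup>2 = 0 then of_nat CARD('k) else 0) - 1)"
    by (subst sum.swap) (simp add: sum_psi_nonzero)
  also have "\<dots> = of_nat (card {x. x\<^sup>2 = - a}) * of_nat CARD('k) - of_nat CARD('k)"
    by (simp add: sum_subtractf sum.If_cases eq_neg_iff_add_eq_0 add.commute)
  also have "\<dots> = of_real ((real (card {x. x\<^sup>2 = - a}) - 1) * real CARD('k))"
    by (simp add: algebra_simps)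
  finally have "norm (\<Sum>s\<in>UNIV - {0}. \<psi> (a * s + b / s) * G s) = \<bar>real (card {x. x\<^sup>2 = - a}) - 1\<bar> * real CARD('k)"
    by (simp only: norm_of_real) (simp add: abs_mult)
  also have "\<dots> \<le> 2 * real CARD('k)"
    using card_roots_square[of "- a"] by (intro mult_right_mono) auto
  finally show ?thesis .
next
  case False
  \<comment> \<open>Completing the square, read backwards, trades \<open>b / s\<close> for a
    quadratic exponent in a new variable \<open>y\<close>; the whole exponent becomes linear in
    \<open>s\<close>.\<close>
  have "\<psi> (a * s + b / s) * G s = eta (- b) * (\<Sum>y\<in>UNIV. \<psi> (2 * b * y) * \<psi> (s * (a - b * y\<^sup>2)))"
    if s: "s \<noteq> 0" for s
  proof -
    have "- (2 * b)\<^sup>2 / (4 * (- b * s)) = b / s"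
      using False s four_nonzero by (simp add: field_simps power2_eq_square)
    then have "(\<Sum>y\<in>UNIV. \<psi> (- b * s * y\<^sup>2 + 2 * b * y)) = \<psi> (b / s) * G (- b * s)"
      using G_linear[of "- b * s" "2 * b"] False s by simp
    also have "G (- b * s) = eta (- b) * G s"
      using G_eta[of s] G_eta[of "- b * s"] eta_mult[of "- b" s] False s by simp
    finally have "\<psi> (b / s) * G s = eta (- b) * (\<Sum>y\<in>UNIV. \<psi> (- b * s * y\<^sup>2 + 2 * b * y))"
      using eta_values[of "- b"] by auto
    then have "\<psi> (a * s + b / s) * G s = eta (- b) * (\<Sum>y\<in>UNIV. \<psi> (a * s) * \<psi> (- b * s * y\<^sup>2 + 2 * b * y))"
      by (simp add: add mult.assoc mult.left_commute flip: sum_distrib_left)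
    also have "(\<Sum>y\<in>UNIV. \<psi> (a * s) * \<psi> (- b * s * y\<^sup>2 + 2 * b * y))
        = (\<Sum>y\<in>UNIV. \<psi> (2 * b * y) * \<psi> (s * (a - b * y\<^sup>2)))"
      unfolding add[symmetric] by (simp add: algebra_simps)
    finally show ?thesis .
  qed
  then have "(\<Sum>s\<in>UNIV - {0}. \<psi> (a * s + b / s) * G s)
      = (\<Sum>s\<in>UNIV - {0}. eta (- b) * (\<Sum>y\<in>UNIV. \<psi> (2 * b * y) * \<psi> (s * (a - b * y\<^sup>2))))"
    by (intro sum.cong) auto
  also have "\<dots> = eta (- b) * (\<Sum>y\<in>UNIV. \<psi> (2 * b * y) * (\<Sum>s\<in>UNIV - {0}. \<psi> (s * (a - b * y\<^sup>2))))"
    unfolding sum_distrib_left[symmetric] by (subst sum.swap) (simp add: sum_distrib_left)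
  \<comment> \<open>Summing over \<open>s\<close> singles out the at most two \<open>y\<close> with
    \<open>y^2 = a / b\<close>; the correction for the missing \<open>s = 0\<close> is a full
    character sum and vanishes.\<close>
  also have "(\<Sum>y\<in>UNIV. \<psi> (2 * b * y) * (\<Sum>s\<in>UNIV - {0}. \<psi> (s * (a - b * y\<^sup>2))))
      = (\<Sum>y\<in>UNIV. (if y\<^sup>2 = a / b then of_nat CARD('k) * \<psi> (2 * b * y) else 0) - \<psi> (y * (2 * b)))"
    unfolding sum_psi_nonzero using False by (intro sum.cong refl) (auto simp: field_simps)
  also have "\<dots> = (\<Sum>y\<in>UNIV. if y\<^sup>2 = a / b then of_nat CARD('k) * \<psi> (2 * b * y) else 0)"
    unfolding sum_subtractf sum_psi using False two_nonzero by simp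
  also have "\<dots> = (\<Sum>y\<in>{y. y\<^sup>2 = a / b}. of_nat CARD('k) * \<psi> (2 * b * y))"
    by (simp add: sum.If_cases)
  finally have "norm (\<Sum>s\<in>UNIV - {0}. \<psi> (a * s + b / s) * G s)
      = norm (\<Sum>y\<in>{y. y\<^sup>2 = a / b}. of_nat CARD('k) * \<psi> (2 * b * y))"
    using eta_values[of "- b"] by (auto simp: norm_mult)
  also have "\<dots> \<le> (\<Sum>y\<in>{y. y\<^sup>2 = a / b}. real CARD('k))"
    by (rule sum_norm_le) (simp add: norm_mult)
  also have "\<dots> = real (card {y. y\<^sup>2 = a / b}) * real CARD('k)"
    by simp
  also have "\<dots> \<le> 2 * real CARD('k)"
    using card_roots_square[of "a / b"] by (intro mult_right_mono) auto
  finally show ?thesis .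
qed

end

section \<open>Fourier transform of spheres\<close>

context finite_field_char
begin

text \<open>The character expansion of \<open>sigma_len\<close> without the frequency
  \<open>s = 0\<close>, which is the main term 1.\<close>

definition tau :: "'k \<Rightarrow> 'k ^ 'd::finite \<Rightarrow> complex" where
  "tau lam x = (\<Sum>s\<in>UNIV - {0}. \<psi> (s * (sqnorm x - lam)))"

lemma sigma_len_tau: "complex_of_real (sigma_len lam x) = 1 + tau lam x"
  unfolding tau_def sum_psi_nonzero by (simp add: sigma_len_def)

text \<open>Not normalised: a factor \<open>q^d\<close> appears in the inversion formula and in
  Parseval's identity.\<close>

definition fourier :: "('k ^ 'd::finite \<Rightarrow> complex) \<Rightarrow> 'k ^ 'd \<Rightarrow> complex" where
  "fourier f xi = (\<Sum>x\<in>UNIV. f x * \<psi> (- dot xi x))"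

lemma sum_psi_dot:
  fixes z :: "'k ^ 'd::finite"
  shows "(\<Sum>xi\<in>UNIV. \<psi> (dot xi z)) = (if z = 0 then of_nat CARD('k) ^ CARD('d) else 0)"
proof -
  have "(\<Sum>xi\<in>UNIV. \<psi> (dot xi z)) = (\<Prod>j\<in>UNIV. \<Sum>y\<in>UNIV. \<psi> (y * z $ j))"
    unfolding dot_def psi_sum by (rule sum_prod_vec)
  also have "\<dots> = (\<Prod>j\<in>UNIV. if z $ j = 0 then of_nat CARD('k) else 0)"
    by (simp add: sum_psi)
  also have "\<dots> = (if z = 0 then of_nat CARD('k) ^ CARD('d) else 0)"
    by (auto simp: vec_eq_iff prod_zero_iff)
  finally show ?thesis .
qed

lemma fourier_inversion:
  fixes f :: "'k ^ 'd::finite \<Rightarrow> complex"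
  shows "(\<Sum>xi\<in>UNIV. fourier f xi * \<psi> (dot xi z)) = of_nat CARD('k) ^ CARD('d) * f z"
proof -
  have "(\<Sum>xi\<in>UNIV. fourier f xi * \<psi> (dot xi z)) = (\<Sum>xi\<in>UNIV. \<Sum>x\<in>UNIV. f x * \<psi> (dot xi (z - x)))"
    unfolding fourier_def sum_distrib_right
    by (intro sum.cong refl) (simp add: dot_diff_right psi_diff psi_minus mult_ac)
  also have "\<dots> = (\<Sum>x\<in>UNIV. f x * (\<Sum>xi\<in>UNIV. \<psi> (dot xi (z - x))))"
    by (subst sum.swap) (simp add: sum_distrib_left)
  also have "\<dots> = (\<Sum>x\<in>UNIV. if x = z then f x * of_nat CARD('k) ^ CARD('d) else 0)"
    unfolding sum_psi_dot by (intro sum.cong) auto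
  finally show ?thesis
    by (simp add: mult.commute)
qed

lemma parseval:
  fixes f :: "'k ^ 'd::finite \<Rightarrow> complex"
  shows "(\<Sum>xi\<in>UNIV. (norm (fourier f xi))\<^sup>2) = real CARD('k) ^ CARD('d) * (\<Sum>x\<in>UNIV. (norm (f x))\<^sup>2)"
proof -
  have "(\<Sum>xi\<in>UNIV. fourier f xi * cnj (fourier f xi))
      = (\<Sum>xi\<in>UNIV. \<Sum>x\<in>UNIV. cnj (f x) * (fourier f xi * \<psi> (dot xi x)))"
    unfolding fourier_def[of f, THEN arg_cong[of _ _ cnj]] cnj_sum sum_distrib_left
    by (intro sum.cong refl) (simp add: psi_minus)
  also have "\<dots> = (\<Sum>x\<in>UNIV. cnj (f x) * (\<Sum>xi\<in>UNIV. fourier f xi * \<psi> (dot xi x)))"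
    by (subst sum.swap) (simp add: sum_distrib_left)
  also have "\<dots> = of_nat CARD('k) ^ CARD('d) * (\<Sum>x\<in>UNIV. f x * cnj (f x))"
    unfolding fourier_inversion by (simp add: sum_distrib_left mult_ac)
  finally have "complex_of_real (\<Sum>xi\<in>UNIV. (norm (fourier f xi))\<^sup>2)
      = of_real (real CARD('k) ^ CARD('d) * (\<Sum>x\<in>UNIV. (norm (f x))\<^sup>2))"
    by (simp only: of_real_sum of_real_mult complex_norm_square of_real_power[of "real CARD('k)"] of_real_of_nat_eq)
  then show ?thesis
    by (simp only: of_real_eq_iff)
qed

text \<open>For fixed \<open>s\<close> the sum over \<open>x\<close> factors over the coordinates,
  and completing the square in each gives one Gauss sum; the constants combine to
  \<open>- sqnorm xi / (4 s)\<close>.\<close>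

lemma fourier_tau_eq:
  fixes xi :: "'k ^ 'd::finite"
  shows "fourier (tau lam) xi = (\<Sum>s\<in>UNIV - {0}. \<psi> (- lam * s + (- sqnorm xi / 4) / s) * G s ^ CARD('d))"
proof -
  have "fourier (tau lam) xi = (\<Sum>s\<in>UNIV - {0}. \<Sum>x\<in>UNIV. \<psi> (s * (sqnorm x - lam)) * \<psi> (- dot xi x))"
    unfolding fourier_def tau_def sum_distrib_right by (rule sum.swap)
  also have "\<dots> = (\<Sum>s\<in>UNIV - {0}. \<psi> (- lam * s + (- sqnorm xi / 4) / s) * G s ^ CARD('d))"
  proof (rule sum.cong[OF refl])
    fix s :: 'k assume "s \<in> UNIV - {0}"
    then have s: "s \<noteq> 0" by simp
    have "\<psi> (s * (sqnorm x - lam)) * \<psi> (- dot xi x)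
        = \<psi> (- lam * s) * (\<Prod>j\<in>UNIV. \<psi> (s * (x $ j)\<^sup>2 + (- xi $ j) * x $ j))" for x
      unfolding psi_sum[symmetric] add[symmetric] sqnorm_def dot_def
      by (simp add: sum.distrib sum_distrib_left sum_negf sum_subtractf algebra_simps power2_eq_square)
    then have "(\<Sum>x\<in>UNIV. \<psi> (s * (sqnorm x - lam)) * \<psi> (- dot xi x))
        = \<psi> (- lam * s) * (\<Prod>j\<in>UNIV. \<Sum>y\<in>UNIV. \<psi> (s * y\<^sup>2 + (- xi $ j) * y))"
      using sum_prod_vec[of "\<lambda>j y. \<psi> (s * y\<^sup>2 + (- xi $ j) * y)"] by (simp only: sum_distrib_left[symmetric])
    also have "(\<Prod>j\<in>UNIV. \<Sum>y\<in>UNIV. \<psi> (s * y\<^sup>2 + (- xi $ j) * y))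
        = (\<Prod>j\<in>UNIV. \<psi> (- (- xi $ j)\<^sup>2 / (4 * s)) * G s)"
      by (simp only: G_linear[OF s])
    also have "\<dots> = \<psi> ((- sqnorm xi / 4) / s) * G s ^ CARD('d)"
    proof -
      have "(- sqnorm xi / 4) / s = (\<Sum>j\<in>UNIV. - (- xi $ j)\<^sup>2 / (4 * s))"
        by (simp add: sqnorm_def power2_eq_square sum_negf sum_divide_distrib)
      then show ?thesis
        by (simp add: prod.distrib psi_sum)
    qed
    finally show "(\<Sum>x\<in>UNIV. \<psi> (s * (sqnorm x - lam)) * \<psi> (- dot xi x))
        = \<psi> (- lam * s + (- sqnorm xi / 4) / s) * G s ^ CARD('d)"
      by (simp only: add mult.assoc)
  qed
  finally show ?thesis .
qed

text \<open>Even powers of \<open>G s\<close> do not depend on \<open>s\<close>, because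
  \<open>G s\<close> is \<open>G 1\<close> up to sign. For even dimension they leave the sum
  altogether; for odd dimension one factor \<open>G s\<close> remains inside.\<close>

lemma norm_fourier_tau:
  fixes xi :: "'k ^ 'd::finite"
  assumes "lam \<noteq> 0"
  shows "norm (fourier (tau lam) xi) \<le> 2 * sqrt (real CARD('k)) ^ (CARD('d) + 1)"
proof (cases "even CARD('d)")
  case True
  then obtain m where m: "CARD('d) = 2 * m" by blast
  have pow: "G s ^ CARD('d) = G 1 ^ CARD('d)" if "s \<noteq> 0" for s
    using G_eta[OF that] eta_values[of s] by (auto simp: m power_mult)
  have "fourier (tau lam) xi
      = (\<Sum>s\<in>UNIV - {0}. \<psi> (- lam * s + (- sqnorm xi / 4) / s)) * G 1 ^ CARD('d)"
    unfolding fourier_tau_eq sum_distrib_right by (intro sum.cong refl arg_cong2[of _ _ _ _ "(*)"] pow) simp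
  then have "norm (fourier (tau lam) xi)
      = norm (\<Sum>s\<in>UNIV - {0}. \<psi> (- lam * s + (- sqnorm xi / 4) / s)) * sqrt (real CARD('k)) ^ CARD('d)"
    by (simp add: norm_mult norm_power norm_G)
  also have "\<dots> \<le> 2 * sqrt (real CARD('k)) * sqrt (real CARD('k)) ^ CARD('d)"
    using assms by (intro mult_right_mono kloosterman_bound) auto
  finally show ?thesis by simp
next
  case False
  then obtain m where m: "CARD('d) = 2 * m + 1"
    using oddE by blast
  have pow: "G s ^ CARD('d) = G s * G 1 ^ (2 * m)" if "s \<noteq> 0" for s
    using G_eta[OF that] eta_values[of s] by (auto simp: m power_mult)
  have "fourier (tau lam) xi
      = (\<Sum>s\<in>UNIV - {0}. \<psi> (- lam * s + (- sqnorm xi / 4) / s) * G s) * G 1 ^ (2 * m)"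
    unfolding fourier_tau_eq sum_distrib_right mult.assoc
    by (intro sum.cong refl arg_cong2[of _ _ _ _ "(*)"] pow) simp
  then have "norm (fourier (tau lam) xi)
      = norm (\<Sum>s\<in>UNIV - {0}. \<psi> (- lam * s + (- sqnorm xi / 4) / s) * G s) * sqrt (real CARD('k)) ^ (2 * m)"
    by (simp add: norm_mult norm_power norm_G)
  also have "\<dots> \<le> 2 * real CARD('k) * sqrt (real CARD('k)) ^ (2 * m)"
    using assms by (intro mult_right_mono salie_bound) auto
  also have "\<dots> = 2 * ((sqrt (real CARD('k)) * sqrt (real CARD('k))) * sqrt (real CARD('k)) ^ (2 * m))"
    by simp
  finally show ?thesis
    by (simp only: m power_Suc mult.assoc add_Suc_right Suc_eq_plus1[symmetric])
qed

text \<open>The Fourier transform diagonalises the kernel, so the uniform bound on its coefficients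
  combines with Cauchy-Schwarz. The factor \<open>q^d\<close> from Parseval cancels the one from
  inversion.\<close>

lemma bilinear_tau_bound:
  fixes f g :: "'k ^ 'd::finite \<Rightarrow> real"
  assumes "lam \<noteq> 0"
  shows "norm (\<Sum>x\<in>UNIV. \<Sum>y\<in>UNIV. of_real (f x * g y) * tau lam (x - y))
    \<le> 2 * sqrt (real CARD('k)) ^ (CARD('d) + 1) * (sqrt (\<Sum>x\<in>UNIV. (f x)\<^sup>2) * sqrt (\<Sum>y\<in>UNIV. (g y)\<^sup>2))"
    (is "norm ?S \<le> ?B * _")
proof -
  define N where "N = real CARD('k) ^ CARD('d)"
  have "N > 0"
    by (simp add: N_def card_gt_0_iff)
  define f' where "f' = fourier (\<lambda>x. complex_of_real (f x))"
  define g' where "g' = fourier (\<lambda>x. complex_of_real (g x))"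
  have "of_real N * ?S = (\<Sum>x\<in>UNIV. \<Sum>y\<in>UNIV. of_real (f x * g y) * (of_nat CARD('k) ^ CARD('d) * tau lam (x - y)))"
    by (simp add: N_def sum_distrib_left mult_ac)
  also have "\<dots> = (\<Sum>x\<in>UNIV. \<Sum>y\<in>UNIV. \<Sum>xi\<in>UNIV. fourier (tau lam) xi *
      (of_real (f x) * \<psi> (dot xi x)) * (of_real (g y) * \<psi> (- dot xi y)))"
    unfolding fourier_inversion[symmetric] sum_distrib_left
    by (intro sum.cong refl) (simp add: dot_diff_right psi_diff psi_minus mult_ac)
  also have "\<dots> = (\<Sum>xi\<in>UNIV. \<Sum>x\<in>UNIV. \<Sum>y\<in>UNIV. fourier (tau lam) xi *
      (of_real (f x) * \<psi> (dot xi x)) * (of_real (g y) * \<psi> (- dot xi y)))"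
    by (rule trans[OF sum.cong[OF refl sum.swap] sum.swap])
  also have "\<dots> = (\<Sum>xi\<in>UNIV. fourier (tau lam) xi * cnj (f' xi) * g' xi)"
  proof (rule sum.cong[OF refl])
    fix xi :: "'k ^ 'd"
    have "cnj (f' xi) = (\<Sum>x\<in>UNIV. of_real (f x) * \<psi> (dot xi x))"
      by (simp add: f'_def fourier_def psi_minus)
    moreover have "g' xi = (\<Sum>y\<in>UNIV. of_real (g y) * \<psi> (- dot xi y))"
      by (simp add: g'_def fourier_def)
    ultimately show "(\<Sum>x\<in>UNIV. \<Sum>y\<in>UNIV. fourier (tau lam) xi * (of_real (f x) * \<psi> (dot xi x)) * (of_real (g y) * \<psi> (- dot xi y)))
        = fourier (tau lam) xi * cnj (f' xi) * g' xi"
      by (simp only: mult.assoc sum_product) (simp only: sum_distrib_left mult.assoc)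
  qed
  finally have eq: "of_real N * ?S = (\<Sum>xi\<in>UNIV. fourier (tau lam) xi * cnj (f' xi) * g' xi)" .
  from arg_cong[OF eq, of norm]
  have "N * norm ?S = norm (\<Sum>xi\<in>UNIV. fourier (tau lam) xi * cnj (f' xi) * g' xi)"
    using \<open>N > 0\<close> by (simp add: norm_mult)
  also have "\<dots> \<le> (\<Sum>xi\<in>UNIV. ?B * (\<bar>norm (f' xi)\<bar> * \<bar>norm (g' xi)\<bar>))"
  proof (rule sum_norm_le)
    fix xi :: "'k ^ 'd"
    show "norm (fourier (tau lam) xi * cnj (f' xi) * g' xi) \<le> ?B * (\<bar>norm (f' xi)\<bar> * \<bar>norm (g' xi)\<bar>)"
      using mult_right_mono[OF norm_fourier_tau[OF assms, of xi], of "norm (f' xi) * norm (g' xi)"]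
      by (simp add: norm_mult mult.assoc)
  qed
  also have "\<dots> \<le> ?B * (L2_set (\<lambda>xi. norm (f' xi)) UNIV * L2_set (\<lambda>xi. norm (g' xi)) UNIV)"
    unfolding sum_distrib_left[symmetric] by (intro mult_left_mono L2_set_mult_ineq) auto
  also have "\<dots> = ?B * (sqrt (N * (\<Sum>x\<in>UNIV. (f x)\<^sup>2)) * sqrt (N * (\<Sum>y\<in>UNIV. (g y)\<^sup>2)))"
    by (simp add: L2_set_def f'_def g'_def parseval N_def)
  also have "\<dots> = N * (?B * (sqrt (\<Sum>x\<in>UNIV. (f x)\<^sup>2) * sqrt (\<Sum>y\<in>UNIV. (g y)\<^sup>2)))"
    using \<open>N > 0\<close> by (simp add: real_sqrt_mult)
  finally show ?thesis
    using \<open>N > 0\<close> by simp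
qed

end

theorem sphere_bilinear_bound:
  fixes f g :: "'k::{field,finite} ^ 'd::finite \<Rightarrow> real"
  assumes "odd CARD('k)" "lam \<noteq> 0"
  shows "\<bar>\<Sum>x\<in>UNIV. \<Sum>y\<in>UNIV. f x * g y * (sigma_len lam (x - y) - 1)\<bar>
    \<le> 2 * sqrt (real CARD('k)) ^ (CARD('d) + 1) * (sqrt (\<Sum>x\<in>UNIV. (f x)\<^sup>2) * sqrt (\<Sum>y\<in>UNIV. (g y)\<^sup>2))"
proof -
  obtain \<psi> :: "'k \<Rightarrow> complex" where \<psi>: "char_on UNIV \<psi>" "\<exists>x. \<psi> x \<noteq> 1"
    using CARD_power_CHAR_and_char_exists[where 'k = 'k] by blast
  interpret finite_field_char \<psi>
    using assms(1) \<psi> by unfold_locales (auto simp: char_on_def)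
  have "complex_of_real (\<Sum>x\<in>UNIV. \<Sum>y\<in>UNIV. f x * g y * (sigma_len lam (x - y) - 1))
      = (\<Sum>x\<in>UNIV. \<Sum>y\<in>UNIV. of_real (f x * g y) * tau lam (x - y))"
    by (simp add: sigma_len_tau)
  from arg_cong[OF this, of norm] show ?thesis
    using bilinear_tau_bound[OF assms(2), of f g] by (simp only: norm_of_real)
qed

section \<open>Counting distance graphs\<close>

lemma sum_PiE_insert:
  fixes f :: "('i \<Rightarrow> 'v) \<Rightarrow> real"
  assumes "i \<notin> W"
  shows "(\<Sum>x\<in>PiE (insert i W) (\<lambda>_. UNIV). f x) = (\<Sum>z\<in>PiE W (\<lambda>_. UNIV). \<Sum>u\<in>UNIV. f (z(i := u)))"
proof -
  have "(\<Sum>z\<in>PiE W (\<lambda>_. UNIV). \<Sum>u\<in>UNIV. f (z(i := u)))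
      = (\<Sum>p\<in>PiE W (\<lambda>_. UNIV) \<times> UNIV. f ((fst p)(i := snd p)))"
    by (simp add: sum.cartesian_product case_prod_unfold)
  also have "\<dots> = (\<Sum>x\<in>PiE (insert i W) (\<lambda>_. UNIV). f x)"
    by (rule sum.reindex_bij_witness[of _ "\<lambda>x. (x(i := undefined), x i)" "\<lambda>p. (fst p)(i := snd p)"])
      (use assms in \<open>auto simp: PiE_def extensional_def fun_eq_iff\<close>)
  finally show ?thesis ..
qed

text \<open>\<open>t\<close> and \<open>m\<close> are fixed upper bounds for degrees and edges, not
  the exact values of one graph, so that the assumption on \<alpha> holds unchanged for every
  subgraph met in the induction.\<close>

locale weighted_count =
  fixes L :: "nat \<Rightarrow> nat \<Rightarrow> 'k::{field,finite}" and A :: "('k ^ 'd::finite) set"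
    and t m :: nat and \<alpha> B :: real
  assumes odd_card: "odd CARD('k)"
    and card_A: "real (card A) = \<alpha> * real CARD('k) ^ CARD('d)"
    and B: "B = real CARD('k) powr (real t - (real CARD('d) + 1) / 2)"
    and alpha: "\<alpha> \<ge> 4 * real m * B" "\<alpha> > 0"
begin

definition D :: real where "D = real CARD('k) ^ CARD('d)"

definition wt :: "(nat \<times> nat) set \<Rightarrow> (nat \<Rightarrow> 'k ^ 'd) \<Rightarrow> real" where
  "wt S x = (\<Prod>(i, j)\<in>S. sigma_len (L i j) (x i - x j))"

definition ind :: "nat set \<Rightarrow> (nat \<Rightarrow> 'k ^ 'd) \<Rightarrow> real" where
  "ind U x = (\<Prod>i\<in>U. indicator A (x i))"

definition total :: "nat set \<Rightarrow> (nat \<times> nat) set \<Rightarrow> real" where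
  "total U S = (\<Sum>x\<in>PiE U (\<lambda>_. UNIV). ind U x * wt S x)"

definition cnt :: "nat set \<Rightarrow> (nat \<times> nat) set \<Rightarrow> real" where
  "cnt U S = total U S / D ^ card U"

definition touching :: "(nat \<times> nat) set \<Rightarrow> nat \<Rightarrow> (nat \<times> nat) set" where
  "touching S v = {p \<in> S. fst p = v \<or> snd p = v}"

definition graph_on :: "nat set \<Rightarrow> (nat \<times> nat) set \<Rightarrow> bool" where
  "graph_on U S \<longleftrightarrow> finite U \<and> S \<subseteq> {(i, j). i \<in> U \<and> j \<in> U \<and> i < j \<and> L i j \<noteq> 0}
     \<and> (\<forall>v. card (touching S v) \<le> t) \<and> card S \<le> m"

lemma q_pos: "real CARD('k) \<ge> 1"
  by (simp add: Suc_le_eq card_gt_0_iff)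

lemma D_pos: "D > 0"
  using q_pos by (simp add: D_def)

lemma B_pos: "B > 0"
  using q_pos by (simp add: B)

lemma sigma_nonneg: "sigma_len lam z \<ge> 0"
  by (simp add: sigma_len_def)

lemma wt_nonneg: "wt S x \<ge> 0"
  unfolding wt_def by (auto intro!: prod_nonneg sigma_nonneg)

lemma ind_nonneg: "ind U x \<ge> 0"
  unfolding ind_def by (auto intro!: prod_nonneg)

lemma total_nonneg: "total U S \<ge> 0"
  unfolding total_def by (intro sum_nonneg mult_nonneg_nonneg ind_nonneg wt_nonneg)

lemma wt_cong: "(\<And>i j. (i, j) \<in> S \<Longrightarrow> x i = y i \<and> x j = y j) \<Longrightarrow> wt S x = wt S y"
  unfolding wt_def by (intro prod.cong) auto

lemma ind_cong: "(\<And>i. i \<in> U \<Longrightarrow> x i = y i) \<Longrightarrow> ind U x = ind U y"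
  unfolding ind_def by (intro prod.cong) auto

lemma wt_square: "finite S \<Longrightarrow> (wt S x)\<^sup>2 = real CARD('k) ^ card S * wt S x"
proof -
  have "(sigma_len lam z)\<^sup>2 = real CARD('k) * sigma_len lam z" for lam :: 'k and z :: "'k ^ 'd"
    by (simp add: sigma_len_def power2_eq_square)
  then show ?thesis
    by (simp add: wt_def case_prod_unfold prod_power_distrib prod.distrib)
qed

lemma wt_Un: "finite S \<Longrightarrow> finite T \<Longrightarrow> S \<inter> T = {} \<Longrightarrow> wt (S \<union> T) x = wt S x * wt T x"
  unfolding wt_def by (rule prod.union_disjoint)

lemma graph_on_finite: "graph_on U S \<Longrightarrow> finite S"
  unfolding graph_on_def by (rule finite_subset[of _ "U \<times> U"]) auto

lemma graph_on_subset:
  assumes "graph_on U S" "S' \<subseteq> S" "finite U'" "\<And>i j. (i, j) \<in> S' \<Longrightarrow> i \<in> U' \<and> j \<in> U'"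
  shows "graph_on U' S'"
proof -
  have fin: "finite S"
    using assms(1) by (rule graph_on_finite)
  have "card (touching S' v) \<le> card (touching S v)" for v
    using assms(2) fin by (intro card_mono) (auto simp: touching_def)
  moreover have "card S' \<le> card S"
    using assms(2) fin by (rule card_mono[rotated])
  moreover have "card (touching S v) \<le> t" "card S \<le> m" for v
    using assms(1) by (auto simp: graph_on_def)
  ultimately have "\<forall>v. card (touching S' v) \<le> t" "card S' \<le> m"
    using le_trans by blast+
  moreover have "S' \<subseteq> {(i, j). i \<in> U' \<and> j \<in> U' \<and> i < j \<and> L i j \<noteq> 0}"
    using assms unfolding graph_on_def by blast
  ultimately show ?thesis
    using assms(3) by (simp add: graph_on_def)
qed

lemma cnt_empty:
  assumes "finite U"
  shows "cnt U {} = \<alpha> ^ card U"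
proof -
  have "total U {} = (\<Sum>x\<in>PiE U (\<lambda>_. UNIV). \<Prod>i\<in>U. indicator A (x i))"
    by (simp add: total_def wt_def ind_def)
  also have "\<dots> = (\<Prod>i\<in>U. \<Sum>u\<in>UNIV. indicator A u)"
    using assms by (intro prod_sum_PiE[symmetric]) auto
  also have "(\<Sum>u\<in>UNIV. indicator A u) = real (card A)"
    by (simp add: indicator_def sum.If_cases)
  also have "(\<Prod>i\<in>U. real (card A)) = (\<alpha> * D) ^ card U"
    by (simp add: card_A D_def)
  finally show ?thesis
    using D_pos by (simp add: cnt_def power_mult_distrib)
qed

text \<open>Squaring a weight only costs a factor \<open>q\<close> per edge, so the \<open>L\<^sup>2\<close> norms produced by
  Cauchy-Schwarz are again counts, for the graph with one vertex removed.\<close>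

lemma sum_square_star:
  assumes S: "graph_on U S" and ij: "i \<in> U" "j \<in> U" "i \<noteq> j"
    and no: "\<And>p. p \<in> S \<Longrightarrow> \<not> (fst p \<in> {i, j} \<and> snd p \<in> {i, j})"
    and deg: "card (touching S i) \<le> t - 1"
    and bound: "cnt (U - {j}) {p \<in> S. fst p \<noteq> j \<and> snd p \<noteq> j} \<le> 2 * \<alpha> ^ (card U - 1)"
  defines "W \<equiv> U - {i, j}" and "T \<equiv> {p \<in> S. fst p \<notin> {i, j} \<and> snd p \<notin> {i, j}}"
  shows "(\<Sum>z\<in>PiE W (\<lambda>_. UNIV). ind W z * wt T z * (\<Sum>u\<in>UNIV. (indicator A u * wt (touching S i) (z(i := u)))\<^sup>2))
    \<le> real CARD('k) ^ (t - 1) * (2 * \<alpha> ^ (card U - 1) * D ^ (card U - 1))"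
    (is "?lhs \<le> _")
proof -
  define S' where "S' = {p \<in> S. fst p \<noteq> j \<and> snd p \<noteq> j}"
  have fin: "finite S" "finite U"
    using graph_on_finite[OF S] S by (simp_all add: graph_on_def)
  have W: "i \<notin> W" "insert i W = U - {j}" "finite W"
    using ij fin by (auto simp: W_def)
  have touch_fin: "finite (touching S i)"
    using fin by (simp add: touching_def)
  have split: "S' = T \<union> touching S i" "T \<inter> touching S i = {}"
    using no ij by (auto simp: S'_def T_def touching_def)
  have "ind W z * wt T z * (indicator A u * wt (touching S i) (z(i := u)))\<^sup>2
      = real CARD('k) ^ card (touching S i) * (ind (insert i W) (z(i := u)) * wt S' (z(i := u)))" for z u
  proof -
    have "wt S' (z(i := u)) = wt T z * wt (touching S i) (z(i := u))"
    proof -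
      have "wt T (z(i := u)) = wt T z"
        by (rule wt_cong) (auto simp: T_def)
      moreover have "finite T"
        using fin by (simp add: T_def)
      ultimately show ?thesis
        using split touch_fin by (simp add: wt_Un)
    qed
    moreover have "ind (insert i W) (z(i := u)) = indicator A u * ind W z"
    proof -
      have "ind W (z(i := u)) = ind W z"
        using W(1) by (intro ind_cong) auto
      then show ?thesis
        using W(1,3) by (simp add: ind_def)
    qed
    moreover have "(indicator A u)\<^sup>2 = (indicator A u :: real)"
      by (simp add: indicator_def)
    ultimately show ?thesis
      using wt_square[OF touch_fin] by (simp add: power_mult_distrib mult_ac)
  qed
  then have "?lhs = (\<Sum>z\<in>PiE W (\<lambda>_. UNIV). \<Sum>u\<in>UNIV.
      real CARD('k) ^ card (touching S i) * (ind (insert i W) (z(i := u)) * wt S' (z(i := u))))"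
    by (simp only: sum_distrib_left)
  also have "\<dots> = real CARD('k) ^ card (touching S i) * total (U - {j}) S'"
    unfolding total_def W(2)[symmetric] sum_PiE_insert[OF W(1)] by (simp add: sum_distrib_left)
  also have "\<dots> \<le> real CARD('k) ^ (t - 1) * total (U - {j}) S'"
    using deg q_pos total_nonneg by (intro mult_right_mono power_increasing) auto
  also have "\<dots> \<le> real CARD('k) ^ (t - 1) * (2 * \<alpha> ^ (card U - 1) * D ^ (card U - 1))"
  proof (rule mult_left_mono)
    have "total (U - {j}) S' = cnt (U - {j}) S' * D ^ (card U - 1)"
      using D_pos ij fin by (simp add: cnt_def card_Diff_singleton)
    also have "\<dots> \<le> 2 * \<alpha> ^ (card U - 1) * D ^ (card U - 1)"
      using bound D_pos by (intro mult_right_mono) (auto simp: S'_def)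
    finally show "total (U - {j}) S' \<le> 2 * \<alpha> ^ (card U - 1) * D ^ (card U - 1)" .
  qed simp
  finally show ?thesis .
qed

text \<open>Origin of the exponent: \<open>(d + 1) / 2\<close> from the Fourier bound,
  \<open>t - 1\<close> from the squared edge weights at the two ends, each under a square root, and
  \<open>-d\<close> because the bounding counts have one vertex less.\<close>

lemma edge_factor_eq:
  assumes "t \<ge> 1"
  shows "2 * sqrt (real CARD('k)) ^ (CARD('d) + 1) * real CARD('k) ^ (t - 1) / D = 2 * B"
proof -
  define d where "d = CARD('d)"
  have q: "real CARD('k) > 0"
    using q_pos by linarith
  have "sqrt (real CARD('k)) ^ (d + 1) = real CARD('k) powr ((real d + 1) / 2)"
    using q by (simp only: powr_half_sqrt[symmetric] powr_realpow[symmetric] powr_powr powr_gt_zero) (simp add: add.commute)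
  moreover have "real CARD('k) ^ (t - 1) = real CARD('k) powr (real t - 1)"
    using q assms by (simp add: of_nat_diff flip: powr_realpow)
  moreover have "D = real CARD('k) powr real d"
    using q by (simp add: D_def d_def powr_realpow)
  ultimately have "sqrt (real CARD('k)) ^ (d + 1) * real CARD('k) ^ (t - 1) / D
      = real CARD('k) powr ((real d + 1) / 2 + (real t - 1) - real d)"
    by (simp only: powr_add powr_diff)
  also have "(real d + 1) / 2 + (real t - 1) - real d = real t - (real d + 1) / 2"
    by (simp add: field_simps)
  finally show ?thesis
    by (simp add: B d_def)
qed

text \<open>With the other vertices frozen at \<open>z\<close>, the old edges split into those
  avoiding \<open>i\<close> and \<open>j\<close>, those at \<open>i\<close> and those at
  \<open>j\<close>. No old edge joins \<open>i\<close> to \<open>j\<close>, so the summand is a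
  product of a function of \<open>u\<close> and one of \<open>v\<close> with the kernel.\<close>

lemma cnt_insert_edge:
  assumes S: "graph_on U (insert (i, j) S)" "(i, j) \<notin> S"
    and bound: "\<And>U' S'. graph_on U' S' \<Longrightarrow> card U' = card U - 1 \<Longrightarrow> cnt U' S' \<le> 2 * \<alpha> ^ card U'"
  shows "\<bar>cnt U (insert (i, j) S) - cnt U S\<bar> \<le> 4 * \<alpha> ^ (card U - 1) * B"
proof -
  have ij: "i \<in> U" "j \<in> U" "i < j" "L i j \<noteq> 0" and finU: "finite U"
    using S(1) by (auto simp: graph_on_def)
  have gS: "graph_on U S"
    by (rule graph_on_subset[OF S(1)]) (use S(1) finU in \<open>auto simp: graph_on_def\<close>)
  then have finS: "finite S"
    by (rule graph_on_finite)
  have lt: "fst p < snd p" if "p \<in> S" for p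
    using that gS by (auto simp: graph_on_def)
  have no: "\<not> (fst p \<in> {i, j} \<and> snd p \<in> {i, j})" if "p \<in> S" for p
    using lt[OF that] that S(2) ij(3) by (cases p) auto
  define W where "W = U - {i, j}"
  define T where "T = {p \<in> S. fst p \<notin> {i, j} \<and> snd p \<notin> {i, j}}"
  define f where "f z u = indicator A u * wt (touching S i) (z(i := u))" for z u
  define g where "g z v = indicator A v * wt (touching S j) (z(j := v))" for z v
  define P where "P z = ind W z * wt T z" for z
  have P_nonneg: "P z \<ge> 0" for z
    by (simp add: P_def ind_nonneg wt_nonneg)
  have W: "i \<notin> insert j W" "j \<notin> W" "insert i (insert j W) = U" "finite W"
    using ij finU by (auto simp: W_def)
  have U_pos: "card U \<ge> 1"
    using ij finU by (metis One_nat_def Suc_leI card_gt_0_iff empty_iff)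
  \<comment> \<open>The new edge takes one place at each of its ends; its presence also gives
    \<open>t >= 1\<close>, so \<open>t - 1\<close> is not truncated.\<close>
  have deg: "card (touching S v) \<le> t - 1" "t \<ge> 1" if v: "v \<in> {i, j}" for v
  proof -
    have "touching (insert (i, j) S) v = insert (i, j) (touching S v)" "(i, j) \<notin> touching S v"
      using v S(2) by (auto simp: touching_def)
    moreover have "finite (touching S v)"
      using finS by (simp add: touching_def)
    ultimately have "Suc (card (touching S v)) = card (touching (insert (i, j) S) v)"
      by simp
    also have "\<dots> \<le> t"
      using S(1) by (simp add: graph_on_def)
    finally show "card (touching S v) \<le> t - 1" "t \<ge> 1"
      by auto
  qed
  have smaller: "cnt (U - {v}) {p \<in> S. fst p \<noteq> v \<and> snd p \<noteq> v} \<le> 2 * \<alpha> ^ (card U - 1)" if v: "v \<in> {i, j}" for v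
  proof -
    have g: "graph_on (U - {v}) {p \<in> S. fst p \<noteq> v \<and> snd p \<noteq> v}"
      using gS by (rule graph_on_subset) (use gS in \<open>auto simp: graph_on_def\<close>)
    have c: "card (U - {v}) = card U - 1"
      using v ij finU by (auto simp: card_Diff_singleton)
    show ?thesis
      using bound[OF g c] unfolding c .
  qed
  define M where "M = real CARD('k) ^ (t - 1) * (2 * \<alpha> ^ (card U - 1) * D ^ (card U - 1))"
  have sq_f: "(\<Sum>z\<in>PiE W (\<lambda>_. UNIV). P z * (\<Sum>u\<in>UNIV. (f z u)\<^sup>2)) \<le> M"
    unfolding P_def f_def M_def W_def T_def
    by (rule sum_square_star[OF gS ij(1,2) _ no deg(1) smaller]) (use ij in auto)
  have sq_g: "(\<Sum>z\<in>PiE W (\<lambda>_. UNIV). P z * (\<Sum>u\<in>UNIV. (g z u)\<^sup>2)) \<le> M"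
    unfolding P_def g_def M_def W_def T_def insert_commute[of i j]
    by (rule sum_square_star[OF gS ij(2,1) _ _ deg(1) smaller]) (use ij no in auto)
  define C where "C = 2 * sqrt (real CARD('k)) ^ (CARD('d) + 1)"
  have "C \<ge> 0"
    by (simp add: C_def)
  have "M \<ge> 0"
    using alpha(2) D_pos by (simp add: M_def)
  have "S = T \<union> (touching S i \<union> touching S j)"
    by (auto simp: T_def touching_def)
  have wt_S: "wt S x = wt T x * (wt (touching S i) x * wt (touching S j) x)" for x
  proof -
    have "finite T" "finite (touching S i)" "finite (touching S j)"
      using finS by (auto simp: T_def touching_def)
    moreover have "touching S i \<inter> touching S j = {}" "T \<inter> (touching S i \<union> touching S j) = {}"
      using no ij(3) by (auto simp: T_def touching_def)
    ultimately show ?thesis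
      by (subst \<open>S = _\<close>) (simp only: wt_Un finite_UnI)
  qed
  have "total U (insert (i, j) S) - total U S
      = (\<Sum>x\<in>PiE U (\<lambda>_. UNIV). ind U x * wt S x * (sigma_len (L i j) (x i - x j) - 1))"
    using S(2) finS by (simp add: total_def wt_def sum_subtractf algebra_simps)
  also have "\<dots> = (\<Sum>z\<in>PiE W (\<lambda>_. UNIV). \<Sum>v\<in>UNIV. \<Sum>u\<in>UNIV.
      P z * (f z u * g z v * (sigma_len (L i j) (u - v) - 1)))"
    unfolding W(3)[symmetric] sum_PiE_insert[OF W(1)] sum_PiE_insert[OF W(2)]
  proof (intro sum.cong refl)
    fix z :: "nat \<Rightarrow> 'k ^ 'd" and u v :: "'k ^ 'd"
    have "i \<noteq> j" using ij by simp
    have "wt T (z(j := v, i := u)) = wt T z"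
      by (rule wt_cong) (auto simp: T_def)
    moreover have "wt (touching S i) (z(j := v, i := u)) = wt (touching S i) (z(i := u))"
    proof (rule wt_cong)
      fix a b assume "(a, b) \<in> touching S i"
      then have "a \<noteq> j \<and> b \<noteq> j"
        using no[of "(a, b)"] ij(3) by (auto simp: touching_def)
      then show "(z(j := v, i := u)) a = (z(i := u)) a \<and> (z(j := v, i := u)) b = (z(i := u)) b"
        by simp
    qed
    moreover have "wt (touching S j) (z(j := v, i := u)) = wt (touching S j) (z(j := v))"
    proof (rule wt_cong)
      fix a b assume "(a, b) \<in> touching S j"
      then have "a \<noteq> i \<and> b \<noteq> i"
        using no[of "(a, b)"] ij(3) by (auto simp: touching_def)
      then show "(z(j := v, i := u)) a = (z(j := v)) a \<and> (z(j := v, i := u)) b = (z(j := v)) b"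
        by simp
    qed
    moreover have "ind (insert i (insert j W)) (z(j := v, i := u)) = indicator A u * (indicator A v * ind W z)"
    proof -
      have "ind W (z(j := v, i := u)) = ind W z"
        using W by (intro ind_cong) auto
      then show ?thesis
        using W(1,2,4) \<open>i \<noteq> j\<close> by (simp add: ind_def)
    qed
    ultimately show "ind (insert i (insert j W)) (z(j := v, i := u)) * wt S (z(j := v, i := u))
        * (sigma_len (L i j) ((z(j := v, i := u)) i - (z(j := v, i := u)) j) - 1)
      = P z * (f z u * g z v * (sigma_len (L i j) (u - v) - 1))"
      using \<open>i \<noteq> j\<close> by (simp add: wt_S P_def f_def g_def mult_ac)
  qed
  also have "\<dots> = (\<Sum>z\<in>PiE W (\<lambda>_. UNIV). P z * (\<Sum>u\<in>UNIV. \<Sum>v\<in>UNIV. f z u * g z v * (sigma_len (L i j) (u - v) - 1)))"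
    unfolding sum_distrib_left by (rule sum.cong[OF refl sum.swap])
  also have "\<bar>\<dots>\<bar> \<le> (\<Sum>z\<in>PiE W (\<lambda>_. UNIV). P z * (C * (sqrt (\<Sum>u\<in>UNIV. (f z u)\<^sup>2) * sqrt (\<Sum>v\<in>UNIV. (g z v)\<^sup>2))))"
  proof (rule order.trans[OF sum_abs sum_mono])
    fix z
    show "\<bar>P z * (\<Sum>u\<in>UNIV. \<Sum>v\<in>UNIV. f z u * g z v * (sigma_len (L i j) (u - v) - 1))\<bar>
        \<le> P z * (C * (sqrt (\<Sum>u\<in>UNIV. (f z u)\<^sup>2) * sqrt (\<Sum>v\<in>UNIV. (g z v)\<^sup>2)))"
      using sphere_bilinear_bound[OF odd_card ij(4), of "f z" "g z"] P_nonneg[of z]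
      by (simp add: abs_mult C_def mult_left_mono)
  qed
  also have "\<dots> = C * (\<Sum>z\<in>PiE W (\<lambda>_. UNIV).
      \<bar>sqrt (P z * (\<Sum>u\<in>UNIV. (f z u)\<^sup>2))\<bar> * \<bar>sqrt (P z * (\<Sum>v\<in>UNIV. (g z v)\<^sup>2))\<bar>)"
  proof (subst sum_distrib_left[of C], rule sum.cong[OF refl])
    fix z
    \<comment> \<open>Distributing the nonnegative weight \<open>P z\<close> over both factors
      prepares the second Cauchy-Schwarz inequality, now over \<open>z\<close>.\<close>
    have "P z = sqrt (P z) * sqrt (P z)"
      using P_nonneg[of z] by simp
    then show "P z * (C * (sqrt (\<Sum>u\<in>UNIV. (f z u)\<^sup>2) * sqrt (\<Sum>v\<in>UNIV. (g z v)\<^sup>2)))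
        = C * (\<bar>sqrt (P z * (\<Sum>u\<in>UNIV. (f z u)\<^sup>2))\<bar> * \<bar>sqrt (P z * (\<Sum>v\<in>UNIV. (g z v)\<^sup>2))\<bar>)"
      using P_nonneg[of z] by (simp add: real_sqrt_mult abs_mult sum_nonneg)
  qed
  also have "\<dots> \<le> C * (L2_set (\<lambda>z. sqrt (P z * (\<Sum>u\<in>UNIV. (f z u)\<^sup>2))) (PiE W (\<lambda>_. UNIV))
      * L2_set (\<lambda>z. sqrt (P z * (\<Sum>v\<in>UNIV. (g z v)\<^sup>2))) (PiE W (\<lambda>_. UNIV)))"
    using \<open>C \<ge> 0\<close> by (intro mult_left_mono L2_set_mult_ineq)
  also have "\<dots> \<le> C * (sqrt M * sqrt M)"
    using sq_f sq_g \<open>C \<ge> 0\<close> \<open>M \<ge> 0\<close> P_nonneg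
    by (intro mult_left_mono mult_mono) (auto simp: L2_set_def sum_nonneg intro!: sum_nonneg mult_nonneg_nonneg)
  also have "\<dots> = C * M"
    using \<open>M \<ge> 0\<close> by simp
  finally have "\<bar>total U (insert (i, j) S) - total U S\<bar> / D ^ card U \<le> C * M / D ^ card U"
    using D_pos by (intro divide_right_mono) auto
  also have "C * M / D ^ card U = (C * real CARD('k) ^ (t - 1) / D) * (2 * \<alpha> ^ (card U - 1))"
  proof -
    have "D ^ card U = D * D ^ (card U - 1)"
      using U_pos by (metis Suc_diff_1 Suc_le_eq One_nat_def power_Suc)
    then show ?thesis
      using D_pos by (simp add: M_def)
  qed
  also have "C * real CARD('k) ^ (t - 1) / D = 2 * B"
    unfolding C_def using edge_factor_eq deg(2)[of i] by simp
  finally show ?thesis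
    using D_pos by (simp add: cnt_def abs_divide diff_divide_distrib[symmetric] mult_ac)
qed

text \<open>By the lower bound on \<alpha>, the error is at most
  \<open>\<alpha> * \<alpha> ^ (card U - 1)\<close>, that is, the main term.\<close>

lemma cnt_upper:
  assumes "\<bar>cnt U S - \<alpha> ^ card U\<bar> \<le> 4 * real (card S) * \<alpha> ^ (card U - 1) * B"
    and "card S \<le> m" "card U \<ge> 1"
  shows "cnt U S \<le> 2 * \<alpha> ^ card U"
proof -
  have "4 * real (card S) * \<alpha> ^ (card U - 1) * B = (4 * real (card S) * B) * \<alpha> ^ (card U - 1)"
    by simp
  also have "\<dots> \<le> \<alpha> * \<alpha> ^ (card U - 1)"
  proof (rule mult_right_mono)
    have "4 * real (card S) * B \<le> 4 * real m * B"
      using assms(2) B_pos by (intro mult_right_mono) auto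
    then show "4 * real (card S) * B \<le> \<alpha>"
      using alpha by linarith
  qed (use alpha in simp)
  also have "\<dots> = \<alpha> ^ card U"
    using assms(3) by (metis Suc_diff_1 Suc_le_eq One_nat_def power_Suc)
  finally show ?thesis
    using assms(1) by linarith
qed

text \<open>Two nested inductions: the outer one on the number of vertices controls the smaller
  counts, the inner one on the edges adds one error term per edge.\<close>

theorem cnt_bound:
  assumes "graph_on U S"
  shows "\<bar>cnt U S - \<alpha> ^ card U\<bar> \<le> 4 * real (card S) * \<alpha> ^ (card U - 1) * B"
  using assms
proof (induction "card U" arbitrary: U S rule: less_induct)
  case less
  have finS: "finite S"
    using less.prems by (rule graph_on_finite)
  have finU: "finite U"
    using less.prems by (simp add: graph_on_def)
  from finS less.prems show ?case
  proof (induction S rule: finite_induct)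
    case empty
    then show ?case
      using cnt_empty[OF finU] by simp
  next
    case (insert p S)
    obtain i j where p: "p = (i, j)" by (cases p)
    have ij: "i \<in> U" "j \<in> U" "i \<noteq> j"
      using insert.prems by (auto simp: graph_on_def p)
    have card_U: "card U \<ge> 2"
      using ij finU card_mono[of U "{i, j}"] by simp
    have "graph_on U S"
      by (rule graph_on_subset[OF insert.prems]) (use insert.prems finU in \<open>auto simp: graph_on_def\<close>)
    then have IH: "\<bar>cnt U S - \<alpha> ^ card U\<bar> \<le> 4 * real (card S) * \<alpha> ^ (card U - 1) * B"
      by (rule insert.IH)
    have "cnt U' S' \<le> 2 * \<alpha> ^ card U'" if "graph_on U' S'" "card U' = card U - 1" for U' S'
    proof (rule cnt_upper)
      show "\<bar>cnt U' S' - \<alpha> ^ card U'\<bar> \<le> 4 * real (card S') * \<alpha> ^ (card U' - 1) * B"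
        using that card_U by (intro less.hyps) auto
      show "card S' \<le> m"
        using that(1) by (simp add: graph_on_def)
      show "card U' \<ge> 1"
        using that(2) card_U by simp
    qed
    then have "\<bar>cnt U (insert p S) - cnt U S\<bar> \<le> 4 * \<alpha> ^ (card U - 1) * B"
      using cnt_insert_edge[of U i j S] insert.prems insert.hyps by (simp add: p)
    moreover have "4 * real (card (insert p S)) * \<alpha> ^ (card U - 1) * B
        = 4 * real (card S) * \<alpha> ^ (card U - 1) * B + 4 * \<alpha> ^ (card U - 1) * B"
      using insert.hyps by (simp add: algebra_simps)
    ultimately show ?case
      using IH by linarith
  qed
qed

end

theorem theorem5p1:
  fixes E :: "nat \<Rightarrow> nat \<Rightarrow> bool"
    and L :: "nat \<Rightarrow> nat \<Rightarrow> 'k::{field,finite}"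
    and A :: "('k ^ 'd::finite) set"
    and n :: nat and \<alpha> :: real
  assumes "odd CARD('k)"
    and "distance_graph n E L"
    and "num_edges n E \<ge> 1"
    and "real (card A) = \<alpha> * real CARD('k) ^ CARD('d)"
    and "\<alpha> \<ge> 4 * real (num_edges n E) *
           real CARD('k) powr (real (max_degree n E) - (real CARD('d) + 1) / 2)"
  shows "\<bar>count_G n E L A - \<alpha> ^ n\<bar> \<le>
           4 * real (num_edges n E) * \<alpha> ^ (n - 1) *
           real CARD('k) powr (real (max_degree n E) - (real CARD('d) + 1) / 2)"
proof -
  define B where "B = real CARD('k) powr (real (max_degree n E) - (real CARD('d) + 1) / 2)"
  have "B > 0"
    by (simp add: B_def card_gt_0_iff)
  then have "0 < 4 * real (num_edges n E) * B"
    using assms(3) by simp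
  then have "\<alpha> > 0"
    using assms(5) unfolding B_def by linarith
  interpret weighted_count L A "max_degree n E" "num_edges n E" \<alpha> B
    using assms \<open>\<alpha> > 0\<close> by unfold_locales (auto simp: B_def)
  define S where "S = {(i, j). i < j \<and> j < n \<and> E i j}"
  have card_S: "card S = num_edges n E"
    by (simp add: S_def num_edges_def)
  have "card (touching S v) \<le> max_degree n E" for v
  proof (cases "v < n")
    case True
    have "card (touching S v) \<le> Defs.degree n E v"
      unfolding Defs.degree_def
    proof (rule card_inj_on_le)
      \<comment> \<open>The map sends an edge at \<open>v\<close> to its other endpoint, whichever
        of the two positions \<open>v\<close> occupies.\<close>
      show "inj_on (\<lambda>p. fst p + snd p - v) (touching S v)"
        by (auto simp: inj_on_def touching_def S_def)
      show "(\<lambda>p. fst p + snd p - v) ` touching S v \<subseteq> {j. j < n \<and> E v j}"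
        using assms(2) by (auto simp: touching_def S_def distance_graph_def)
    qed simp
    also have "\<dots> \<le> max_degree n E"
      unfolding max_degree_def using True by (intro Max_ge) auto
    finally show ?thesis .
  next
    case False
    then have "touching S v = {}"
      by (auto simp: touching_def S_def)
    then show ?thesis by simp
  qed
  then have "graph_on {..<n} S"
    using assms(2) card_S by (auto simp: graph_on_def S_def distance_graph_def)
  then have "\<bar>cnt {..<n} S - \<alpha> ^ n\<bar> \<le> 4 * real (num_edges n E) * \<alpha> ^ (n - 1) * B"
    using cnt_bound[of "{..<n}" S] by (simp add: card_S)
  moreover have "count_G n E L A = cnt {..<n} S"
  proof -
    have "(\<Prod>i<n. indicator A (x i) * (\<Prod>j\<in>{i<..<n}. sigma_ij E L i j (x i - x j)))
        = ind {..<n} x * wt S x" for x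
    proof -
      have "(\<Prod>i<n. \<Prod>j\<in>{i<..<n}. sigma_ij E L i j (x i - x j))
          = (\<Prod>(i, j)\<in>(SIGMA i:{..<n}. {i<..<n}). sigma_ij E L i j (x i - x j))"
        by (rule prod.Sigma) auto
      \<comment> \<open>Pairs that are not edges contribute the factor 1, so the product over all
        pairs reduces to the edges.\<close>
      also have "\<dots> = wt S x"
        unfolding wt_def by (rule prod.mono_neutral_cong_right) (auto simp: S_def sigma_ij_def split: if_splits)
      finally show ?thesis
        by (simp add: prod.distrib ind_def)
    qed
    then show ?thesis
      by (simp add: count_G_def cnt_def total_def D_def power_divide)
  qed
  ultimately show ?thesis
    by (simp add: B_def)
qed

end
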